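(* Let $i:Z\hookrightarrow X$ be a closed immersion with open complement $j:U\hookrightarrow X$, and assume the recollement axioms for $(i,j)$. Then for every $A\in\mathcal C(X)$ there is a long exact sequence, functorial in $A$, $$\cdots\longrightarrow H_Z^{d}(X;A)\xrightarrow{\mathrm{forg}}H^{d}(X;A)\xrightarrow{j^*}H^{d}(U;j^*A)\xrightarrow{\delta}H_Z^{d+1}(X;A)\longrightarrow\cdots.$$
   Context: Setting: to each space $X$ (in a fixed category of spaces with closed immersions, open complements, Cartesian squares and proper morphisms) is attached a stable triangulated category $\mathcal C(X)$ with a symmetric monoidal structure $(\otimes,\mathbf 1_X)$. Each morphism $f:X\to Y$ has exact functors $f^*\dashv f_*$, with $f^*$ symmetric monoidal, so $f^*\mathbf 1_Y\simeq\mathbf 1_X$. Recollement axioms for a closed immersion $i:Z\hookrightarrow X$ with open complement $j:U=X\setminus Z\hookrightarrow X$: adjunctions $i^*\dashv i_*\dashv i^!$ and $j_!\dashv j^*\dashv j_*$; $i_*$ and $j_!$ are fully faithful; $j^*i_*=0$ and $i^*j_!=0$; and for each $M\in\mathcal C(X)$ functorial distinguished triangles $j_!j^*M\to M\to i_*i^*M\xrightarrow{+1}$ and $i_*i^!M\to M\to j_*j^*M\xrightarrow{+1}$, whose maps to and from $M$ are the adjunction counits and units. Definitions: $H^d(X;A)=\mathrm{Hom}_{\mathcal C(X)}(\mathbf 1_X,A[d])$; $H_Z^d(X;A)=\mathrm{Hom}_{\mathcal C(X)}(\mathbf 1_X,i_*i^!A[d])$; $\mathrm{forg}:H_Z^d(X;A)\to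 H^d(X;A)$ is induced by the counit $i_*i^!A\to A$. The map $j^*$ is induced by the unit $A\to j_*j^*A$ and the identification $\mathrm{Hom}_{\mathcal C(X)}(\mathbf 1_X,j_*j^*A[d])\cong\mathrm{Hom}_{\mathcal C(U)}(\mathbf 1_U,j^*A[d])=H^d(U;j^*A)$. The map $\delta$ is the connecting morphism of the triangle $i_*i^!A\to A\to j_*j^*A\xrightarrow{+1}$. *)

theory Defs
  imports "HOL-Algebra.Exact_Sequence"
begin

section \<open>Categories, functors, adjunctions\<close>

record ('o, 'a) cat =
  Ob :: "'o set"
  Arr :: "'a set"
  Dom :: "'a \<Rightarrow> 'o"
  Cod :: "'a \<Rightarrow> 'o"
  Ident :: "'o \<Rightarrow> 'a"
  Comp :: "'a \<Rightarrow> 'a \<Rightarrow> 'a"  (infixl \<open>\<cdot>\<index>\<close> 70)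

definition Hom :: "('o, 'a, 'z) cat_scheme \<Rightarrow> 'o \<Rightarrow> 'o \<Rightarrow> 'a set" where
  "Hom C a b = {f \<in> Arr C. Dom C f = a \<and> Cod C f = b}"

locale category =
  fixes C :: "('o, 'a, 'z) cat_scheme" (structure)
  assumes dom_closed: "f \<in> Arr C \<Longrightarrow> Dom C f \<in> Ob C"
    and cod_closed: "f \<in> Arr C \<Longrightarrow> Cod C f \<in> Ob C"
    and ident_hom: "a \<in> Ob C \<Longrightarrow> Ident C a \<in> Hom C a a"
    and comp_hom: "\<lbrakk>f \<in> Hom C a b; g \<in> Hom C b c\<rbrakk> \<Longrightarrow> g \<cdot> f \<in> Hom C a c"
    and comp_ident: "f \<in> Hom C a b \<Longrightarrow> f \<cdot> Ident C a = f"
    and ident_comp: "f \<in> Hom C a b \<Longrightarrow> Ident C b \<cdot> f = f"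
    and comp_assoc:
      "\<lbrakk>f \<in> Hom C a b; g \<in> Hom C b c; h \<in> Hom C c d\<rbrakk> \<Longrightarrow> (h \<cdot> g) \<cdot> f = h \<cdot> (g \<cdot> f)"

definition inverse_arrows :: "('o, 'a, 'z) cat_scheme \<Rightarrow> 'a \<Rightarrow> 'a \<Rightarrow> bool" where
  "inverse_arrows C f g \<longleftrightarrow>
     f \<in> Arr C \<and> g \<in> Hom C (Cod C f) (Dom C f) \<and>
     g \<cdot>\<^bsub>C\<^esub> f = Ident C (Dom C f) \<and> f \<cdot>\<^bsub>C\<^esub> g = Ident C (Cod C f)"

definition iso_arrow :: "('o, 'a, 'z) cat_scheme \<Rightarrow> 'a \<Rightarrow> bool" where
  "iso_arrow C f \<longleftrightarrow> (\<exists>g. inverse_arrows C f g)"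

definition inv_arrow :: "('o, 'a, 'z) cat_scheme \<Rightarrow> 'a \<Rightarrow> 'a" where
  "inv_arrow C f = (THE g. inverse_arrows C f g)"

definition zero_object :: "('o, 'a, 'z) cat_scheme \<Rightarrow> 'o \<Rightarrow> bool" where
  "zero_object C z \<longleftrightarrow>
     z \<in> Ob C \<and> (\<forall>a\<in>Ob C. (\<exists>!f. f \<in> Hom C a z) \<and> (\<exists>!f. f \<in> Hom C z a))"

definition prod_cat ::
    "('o, 'a, 'z) cat_scheme \<Rightarrow> ('p, 'b, 'y) cat_scheme \<Rightarrow> ('o \<times> 'p, 'a \<times> 'b) cat" where
  "prod_cat C D =
     \<lparr>Ob = Ob C \<times> Ob D, Arr = Arr C \<times> Arr D,
      Dom = (\<lambda>(f, g). (Dom C f, Dom D g)), Cod = (\<lambda>(f, g). (Cod C f, Cod D g)),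
      Ident = (\<lambda>(a, b). (Ident C a, Ident D b)),
      Comp = (\<lambda>(f', g') (f, g). (f' \<cdot>\<^bsub>C\<^esub> f, g' \<cdot>\<^bsub>D\<^esub> g))\<rparr>"

record ('o, 'a, 'p, 'b) funct =
  fob :: "'o \<Rightarrow> 'p"
  farr :: "'a \<Rightarrow> 'b"

locale is_functor = source: category C + target: category D
  for C :: "('o, 'a, 'z) cat_scheme" and D :: "('p, 'b, 'y) cat_scheme" +
  fixes F :: "('o, 'a, 'p, 'b) funct"
  assumes fob_closed: "a \<in> Ob C \<Longrightarrow> fob F a \<in> Ob D"
    and farr_hom: "f \<in> Hom C a b \<Longrightarrow> farr F f \<in> Hom D (fob F a) (fob F b)"
    and farr_ident: "a \<in> Ob C \<Longrightarrow> farr F (Ident C a) = Ident D (fob F a)"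
    and farr_comp: "\<lbrakk>f \<in> Hom C a b; g \<in> Hom C b c\<rbrakk> \<Longrightarrow>
      farr F (g \<cdot>\<^bsub>C\<^esub> f) = farr F g \<cdot>\<^bsub>D\<^esub> farr F f"

definition id_funct :: "('o, 'a, 'o, 'a) funct" where
  "id_funct = \<lparr>fob = (\<lambda>a. a), farr = (\<lambda>f. f)\<rparr>"

definition comp_funct ::
    "('p, 'b, 'q, 'c) funct \<Rightarrow> ('o, 'a, 'p, 'b) funct \<Rightarrow> ('o, 'a, 'q, 'c) funct"
    (infixr \<open>\<circ>\<^sub>F\<close> 75) where
  "G \<circ>\<^sub>F F = \<lparr>fob = fob G \<circ> fob F, farr = farr G \<circ> farr F\<rparr>"

definition fully_faithful ::
    "('o, 'a, 'z) cat_scheme \<Rightarrow> ('p, 'b, 'y) cat_scheme \<Rightarrow> ('o, 'a, 'p, 'b) funct \<Rightarrow> bool" where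
  "fully_faithful C D F \<longleftrightarrow>
     (\<forall>a\<in>Ob C. \<forall>b\<in>Ob C. bij_betw (farr F) (Hom C a b) (Hom D (fob F a) (fob F b)))"

locale nat_trans = source: is_functor C D F + target: is_functor C D G
  for C :: "('o, 'a, 'z) cat_scheme" and D :: "('p, 'b, 'y) cat_scheme"
    and F G :: "('o, 'a, 'p, 'b) funct" +
  fixes t :: "'o \<Rightarrow> 'b"
  assumes component: "a \<in> Ob C \<Longrightarrow> t a \<in> Hom D (fob F a) (fob G a)"
    and naturality: "f \<in> Hom C a b \<Longrightarrow> t b \<cdot>\<^bsub>D\<^esub> farr F f = farr G f \<cdot>\<^bsub>D\<^esub> t a"

locale nat_iso = nat_trans +
  assumes component_iso: "a \<in> Ob C \<Longrightarrow> iso_arrow D (t a)"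

locale adjunction = left: is_functor C D F + right: is_functor D C G +
    unit: nat_trans C C id_funct "G \<circ>\<^sub>F F" \<eta> + counit: nat_trans D D "F \<circ>\<^sub>F G" id_funct \<epsilon>
  for C :: "('o, 'a, 'z) cat_scheme" and D :: "('p, 'b, 'y) cat_scheme"
    and F :: "('o, 'a, 'p, 'b) funct" and G :: "('p, 'b, 'o, 'a) funct"
    and \<eta> :: "'o \<Rightarrow> 'a" and \<epsilon> :: "'p \<Rightarrow> 'b" +
  assumes triangle_left: "a \<in> Ob C \<Longrightarrow>
      \<epsilon> (fob F a) \<cdot>\<^bsub>D\<^esub> farr F (\<eta> a) = Ident D (fob F a)"
    and triangle_right: "b \<in> Ob D \<Longrightarrow>
      farr G (\<epsilon> b) \<cdot>\<^bsub>C\<^esub> \<eta> (fob G b) = Ident C (fob G b)"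


section \<open>Triangulated categories\<close>

text \<open>
  The shift is an autoequivalence, not necessarily an automorphism: a quasi-inverse and
  the unit and counit of an adjoint equivalence are part of the data, so that negative shifts
  and the canonical isomorphisms between iterated shifts are determined.
\<close>

record ('o, 'a) tricat = "('o, 'a) cat" +
  Add :: "'a \<Rightarrow> 'a \<Rightarrow> 'a"
  Zero :: "'o \<Rightarrow> 'o \<Rightarrow> 'a"
  Shift :: "('o, 'a, 'o, 'a) funct"
  Unshift :: "('o, 'a, 'o, 'a) funct"
  shift_unit :: "'o \<Rightarrow> 'a"
  shift_counit :: "'o \<Rightarrow> 'a"
  Dist :: "('a \<times> 'a \<times> 'a) set"

definition hom_group :: "('o, 'a, 'z) tricat_scheme \<Rightarrow> 'o \<Rightarrow> 'o \<Rightarrow> 'a monoid" where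
  "hom_group C a b = \<lparr>carrier = Hom C a b, mult = Add C, one = Zero C a b\<rparr>"

definition Neg :: "('o, 'a, 'z) tricat_scheme \<Rightarrow> 'a \<Rightarrow> 'a" where
  "Neg C f = inv\<^bsub>hom_group C (Dom C f) (Cod C f)\<^esub> f"

locale additive_category = category C for C :: "('o, 'a, 'z) tricat_scheme" (structure) +
  assumes hom_comm_group: "\<lbrakk>a \<in> Ob C; b \<in> Ob C\<rbrakk> \<Longrightarrow> comm_group (hom_group C a b)"
    and comp_add: "\<lbrakk>f \<in> Hom C a b; f' \<in> Hom C a b; g \<in> Hom C b c\<rbrakk> \<Longrightarrow>
      g \<cdot> Add C f f' = Add C (g \<cdot> f) (g \<cdot> f')"
    and add_comp: "\<lbrakk>f \<in> Hom C a b; g \<in> Hom C b c; g' \<in> Hom C b c\<rbrakk> \<Longrightarrow>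
      Add C g g' \<cdot> f = Add C (g \<cdot> f) (g' \<cdot> f)"
    and has_zero_object: "\<exists>z. zero_object C z"
    and has_biproducts: "\<lbrakk>a \<in> Ob C; b \<in> Ob C\<rbrakk> \<Longrightarrow>
      \<exists>s\<in>Ob C. \<exists>\<iota>\<^sub>1 \<in> Hom C a s. \<exists>\<iota>\<^sub>2 \<in> Hom C b s. \<exists>\<pi>\<^sub>1 \<in> Hom C s a. \<exists>\<pi>\<^sub>2 \<in> Hom C s b.
        \<pi>\<^sub>1 \<cdot> \<iota>\<^sub>1 = Ident C a \<and> \<pi>\<^sub>2 \<cdot> \<iota>\<^sub>2 = Ident C b \<and>
        \<pi>\<^sub>1 \<cdot> \<iota>\<^sub>2 = Zero C b a \<and> \<pi>\<^sub>2 \<cdot> \<iota>\<^sub>1 = Zero C a b \<and>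
        Add C (\<iota>\<^sub>1 \<cdot> \<pi>\<^sub>1) (\<iota>\<^sub>2 \<cdot> \<pi>\<^sub>2) = Ident C s"

locale additive_functor = is_functor C D F
  for C :: "('o, 'a, 'z) tricat_scheme" and D :: "('p, 'b, 'y) tricat_scheme"
    and F :: "('o, 'a, 'p, 'b) funct" +
  assumes farr_add: "\<lbrakk>f \<in> Hom C a b; g \<in> Hom C a b\<rbrakk> \<Longrightarrow>
      farr F (Add C f g) = Add D (farr F f) (farr F g)"

definition is_triangle :: "('o, 'a, 'z) tricat_scheme \<Rightarrow> 'a \<Rightarrow> 'a \<Rightarrow> 'a \<Rightarrow> bool" where
  "is_triangle C f g h \<longleftrightarrow>
     (\<exists>a b c. f \<in> Hom C a b \<and> g \<in> Hom C b c \<and> h \<in> Hom C c (fob (Shift C) a))"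

definition triangle_map ::
    "('o, 'a, 'z) tricat_scheme \<Rightarrow> 'a \<times> 'a \<times> 'a \<Rightarrow> 'a \<times> 'a \<times> 'a \<Rightarrow> 'a \<times> 'a \<times> 'a \<Rightarrow> bool" where
  "triangle_map C = (\<lambda>(u, v, w) (f, g, h) (f', g', h').
     u \<in> Hom C (Dom C f) (Dom C f') \<and> v \<in> Hom C (Cod C f) (Cod C f') \<and>
     w \<in> Hom C (Cod C g) (Cod C g') \<and>
     v \<cdot>\<^bsub>C\<^esub> f = f' \<cdot>\<^bsub>C\<^esub> u \<and> w \<cdot>\<^bsub>C\<^esub> g = g' \<cdot>\<^bsub>C\<^esub> v \<and>
     farr (Shift C) u \<cdot>\<^bsub>C\<^esub> h = h' \<cdot>\<^bsub>C\<^esub> w)"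

locale triangulated_category = additive_category C +
    shift: additive_functor C C "Shift C" +
    shift_adj: adjunction C C "Shift C" "Unshift C" "shift_unit C" "shift_counit C"
  for C :: "('o, 'a, 'z) tricat_scheme" (structure) +
  assumes shift_unit_iso: "a \<in> Ob C \<Longrightarrow> iso_arrow C (shift_unit C a)"
    and shift_counit_iso: "a \<in> Ob C \<Longrightarrow> iso_arrow C (shift_counit C a)"
    and dist_triangle: "(f, g, h) \<in> Dist C \<Longrightarrow> is_triangle C f g h"
    and dist_iso_closed: "\<lbrakk>(f, g, h) \<in> Dist C; is_triangle C f' g' h';
        triangle_map C (u, v, w) (f, g, h) (f', g', h');
        iso_arrow C u; iso_arrow C v; iso_arrow C w\<rbrakk> \<Longrightarrow> (f', g', h') \<in> Dist C"
    and TR1_ident: "\<lbrakk>a \<in> Ob C; zero_object C z\<rbrakk> \<Longrightarrow>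
        (Ident C a, Zero C a z, Zero C z (fob (Shift C) a)) \<in> Dist C"
    and TR1_cone: "f \<in> Arr C \<Longrightarrow> \<exists>g h. (f, g, h) \<in> Dist C"
    and TR2: "is_triangle C f g h \<Longrightarrow>
        (f, g, h) \<in> Dist C \<longleftrightarrow> (g, h, Neg C (farr (Shift C) f)) \<in> Dist C"
    and TR3: "\<lbrakk>(f, g, h) \<in> Dist C; (f', g', h') \<in> Dist C;
        u \<in> Hom C (Dom C f) (Dom C f'); v \<in> Hom C (Cod C f) (Cod C f'); v \<cdot> f = f' \<cdot> u\<rbrakk> \<Longrightarrow>
        \<exists>w. triangle_map C (u, v, w) (f, g, h) (f', g', h')"
    and TR4: "\<lbrakk>f \<in> Hom C a b; g \<in> Hom C b c;
        (f, p, p') \<in> Dist C; (g, q, q') \<in> Dist C; (g \<cdot> f, r, r') \<in> Dist C\<rbrakk> \<Longrightarrow>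
        \<exists>s t. (s, t, farr (Shift C) p \<cdot> q') \<in> Dist C \<and>
          s \<in> Hom C (Cod C p) (Cod C r) \<and> t \<in> Hom C (Cod C r) (Cod C q) \<and>
          s \<cdot> p = r \<cdot> g \<and> r' \<cdot> s = p' \<and> t \<cdot> r = q \<and> q' \<cdot> t = farr (Shift C) f \<cdot> r'"

locale exact_functor = source_tri: triangulated_category C + target_tri: triangulated_category D +
    additive_functor C D F + commute: nat_iso C D "F \<circ>\<^sub>F Shift C" "Shift D \<circ>\<^sub>F F" \<phi>
  for C :: "('o, 'a, 'z) tricat_scheme" and D :: "('p, 'b, 'y) tricat_scheme"
    and F :: "('o, 'a, 'p, 'b) funct" and \<phi> :: "'o \<Rightarrow> 'b" +
  assumes preserves_dist: "(f, g, h) \<in> Dist C \<Longrightarrow>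
      (farr F f, farr F g, \<phi> (Dom C f) \<cdot>\<^bsub>D\<^esub> farr F h) \<in> Dist D"

text \<open>The object and arrow parts of the functor $[d]$.\<close>

definition shift_ob :: "('o, 'a, 'z) tricat_scheme \<Rightarrow> int \<Rightarrow> 'o \<Rightarrow> 'o" where
  "shift_ob C d =
     (if 0 \<le> d then fob (Shift C) ^^ nat d else fob (Unshift C) ^^ nat (- d))"

definition shift_arr :: "('o, 'a, 'z) tricat_scheme \<Rightarrow> int \<Rightarrow> 'a \<Rightarrow> 'a" where
  "shift_arr C d =
     (if 0 \<le> d then farr (Shift C) ^^ nat d else farr (Unshift C) ^^ nat (- d))"

text \<open>The canonical isomorphism $(B[1])[d] \to B[d+1]$.\<close>

definition shift_succ :: "('o, 'a, 'z) tricat_scheme \<Rightarrow> int \<Rightarrow> 'o \<Rightarrow> 'a" where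
  "shift_succ C d B =
     (if 0 \<le> d then Ident C (shift_ob C (d + 1) B)
      else shift_arr C (d + 1) (inv_arrow C (shift_unit C B)))"

text \<open>
  For an exact functor $(F, \varphi)$ the isomorphism $\varphi : F(A[1]) \to (FA)[1]$ induces
  $F(A[d]) \to (FA)[d]$ for all integers $d$.  In degree $-1$ it is the mate of
  $\varphi^{-1}$, i.e. the composite
  $F(A[-1]) \to (F(A[-1])[1])[-1] \to F(A[-1][1])[-1] \to (FA)[-1]$.
\<close>

primrec commute_pos :: "('p, 'b, 'y) tricat_scheme \<Rightarrow> ('o, 'a, 'z) tricat_scheme \<Rightarrow>
    ('o, 'a, 'p, 'b) funct \<Rightarrow> ('o \<Rightarrow> 'b) \<Rightarrow> nat \<Rightarrow> 'o \<Rightarrow> 'b" where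
  "commute_pos D C F \<phi> 0 A = Ident D (fob F A)"
| "commute_pos D C F \<phi> (Suc n) A =
     farr (Shift D) (commute_pos D C F \<phi> n A) \<cdot>\<^bsub>D\<^esub> \<phi> ((fob (Shift C) ^^ n) A)"

definition commute_unshift :: "('p, 'b, 'y) tricat_scheme \<Rightarrow> ('o, 'a, 'z) tricat_scheme \<Rightarrow>
    ('o, 'a, 'p, 'b) funct \<Rightarrow> ('o \<Rightarrow> 'b) \<Rightarrow> 'o \<Rightarrow> 'b" where
  "commute_unshift D C F \<phi> A =
     farr (Unshift D)
       (farr F (shift_counit C A) \<cdot>\<^bsub>D\<^esub> inv_arrow D (\<phi> (fob (Unshift C) A)))
     \<cdot>\<^bsub>D\<^esub> shift_unit D (fob F (fob (Unshift C) A))"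

primrec commute_neg :: "('p, 'b, 'y) tricat_scheme \<Rightarrow> ('o, 'a, 'z) tricat_scheme \<Rightarrow>
    ('o, 'a, 'p, 'b) funct \<Rightarrow> ('o \<Rightarrow> 'b) \<Rightarrow> nat \<Rightarrow> 'o \<Rightarrow> 'b" where
  "commute_neg D C F \<phi> 0 A = Ident D (fob F A)"
| "commute_neg D C F \<phi> (Suc n) A =
     farr (Unshift D) (commute_neg D C F \<phi> n A)
     \<cdot>\<^bsub>D\<^esub> commute_unshift D C F \<phi> ((fob (Unshift C) ^^ n) A)"

definition commute_shift :: "('p, 'b, 'y) tricat_scheme \<Rightarrow> ('o, 'a, 'z) tricat_scheme \<Rightarrow>
    ('o, 'a, 'p, 'b) funct \<Rightarrow> ('o \<Rightarrow> 'b) \<Rightarrow> int \<Rightarrow> 'o \<Rightarrow> 'b" where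
  "commute_shift D C F \<phi> d =
     (if 0 \<le> d then commute_pos D C F \<phi> (nat d) else commute_neg D C F \<phi> (nat (- d)))"


section \<open>Symmetric monoidal categories and functors\<close>

record ('o, 'a) monoidal_data =
  Tensor :: "('o \<times> 'o, 'a \<times> 'a, 'o, 'a) funct"
  tensor_unit :: "'o"
  associator :: "'o \<Rightarrow> 'o \<Rightarrow> 'o \<Rightarrow> 'a"
  left_unitor :: "'o \<Rightarrow> 'a"
  right_unitor :: "'o \<Rightarrow> 'a"
  braiding :: "'o \<Rightarrow> 'o \<Rightarrow> 'a"

definition tensor_ob :: "('o, 'a) monoidal_data \<Rightarrow> 'o \<Rightarrow> 'o \<Rightarrow> 'o" where
  "tensor_ob M a b = fob (Tensor M) (a, b)"

definition tensor_arr :: "('o, 'a) monoidal_data \<Rightarrow> 'a \<Rightarrow> 'a \<Rightarrow> 'a" where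
  "tensor_arr M f g = farr (Tensor M) (f, g)"

locale symmetric_monoidal_category = category C +
    tensor: is_functor "prod_cat C C" C "Tensor M"
  for C :: "('o, 'a, 'z) cat_scheme" (structure) and M :: "('o, 'a) monoidal_data" +
  assumes unit_closed: "tensor_unit M \<in> Ob C"
    and associator_hom: "\<lbrakk>a \<in> Ob C; b \<in> Ob C; c \<in> Ob C\<rbrakk> \<Longrightarrow>
      associator M a b c \<in> Hom C (tensor_ob M (tensor_ob M a b) c) (tensor_ob M a (tensor_ob M b c))"
    and associator_iso: "\<lbrakk>a \<in> Ob C; b \<in> Ob C; c \<in> Ob C\<rbrakk> \<Longrightarrow> iso_arrow C (associator M a b c)"
    and associator_natural: "\<lbrakk>f \<in> Hom C a a'; g \<in> Hom C b b'; h \<in> Hom C c c'\<rbrakk> \<Longrightarrow>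
      associator M a' b' c' \<cdot> tensor_arr M (tensor_arr M f g) h
        = tensor_arr M f (tensor_arr M g h) \<cdot> associator M a b c"
    and left_unitor_hom: "a \<in> Ob C \<Longrightarrow> left_unitor M a \<in> Hom C (tensor_ob M (tensor_unit M) a) a"
    and left_unitor_iso: "a \<in> Ob C \<Longrightarrow> iso_arrow C (left_unitor M a)"
    and left_unitor_natural: "f \<in> Hom C a b \<Longrightarrow>
      left_unitor M b \<cdot> tensor_arr M (Ident C (tensor_unit M)) f = f \<cdot> left_unitor M a"
    and right_unitor_hom: "a \<in> Ob C \<Longrightarrow> right_unitor M a \<in> Hom C (tensor_ob M a (tensor_unit M)) a"
    and right_unitor_iso: "a \<in> Ob C \<Longrightarrow> iso_arrow C (right_unitor M a)"
    and right_unitor_natural: "f \<in> Hom C a b \<Longrightarrow>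
      right_unitor M b \<cdot> tensor_arr M f (Ident C (tensor_unit M)) = f \<cdot> right_unitor M a"
    and braiding_hom: "\<lbrakk>a \<in> Ob C; b \<in> Ob C\<rbrakk> \<Longrightarrow>
      braiding M a b \<in> Hom C (tensor_ob M a b) (tensor_ob M b a)"
    and braiding_natural: "\<lbrakk>f \<in> Hom C a a'; g \<in> Hom C b b'\<rbrakk> \<Longrightarrow>
      braiding M a' b' \<cdot> tensor_arr M f g = tensor_arr M g f \<cdot> braiding M a b"
    and braiding_symmetric: "\<lbrakk>a \<in> Ob C; b \<in> Ob C\<rbrakk> \<Longrightarrow>
      braiding M b a \<cdot> braiding M a b = Ident C (tensor_ob M a b)"
    and pentagon: "\<lbrakk>a \<in> Ob C; b \<in> Ob C; c \<in> Ob C; d \<in> Ob C\<rbrakk> \<Longrightarrow>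
      associator M a b (tensor_ob M c d) \<cdot> associator M (tensor_ob M a b) c d
        = tensor_arr M (Ident C a) (associator M b c d)
          \<cdot> (associator M a (tensor_ob M b c) d \<cdot> tensor_arr M (associator M a b c) (Ident C d))"
    and triangle: "\<lbrakk>a \<in> Ob C; b \<in> Ob C\<rbrakk> \<Longrightarrow>
      tensor_arr M (Ident C a) (left_unitor M b) \<cdot> associator M a (tensor_unit M) b
        = tensor_arr M (right_unitor M a) (Ident C b)"
    and hexagon: "\<lbrakk>a \<in> Ob C; b \<in> Ob C; c \<in> Ob C\<rbrakk> \<Longrightarrow>
      associator M b c a \<cdot> (braiding M a (tensor_ob M b c) \<cdot> associator M a b c)
        = tensor_arr M (Ident C b) (braiding M a c)
          \<cdot> (associator M b a c \<cdot> tensor_arr M (braiding M a b) (Ident C c))"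

text \<open>
  Strong symmetric monoidal functors, with structure isomorphisms
  $\mu : Fa \otimes Fb \to F(a \otimes b)$ and $e : \mathbf 1 \to F \mathbf 1$.
\<close>

locale symmetric_monoidal_functor = is_functor C D F +
    source_mon: symmetric_monoidal_category C M + target_mon: symmetric_monoidal_category D N
  for C :: "('o, 'a, 'z) cat_scheme" and M :: "('o, 'a) monoidal_data"
    and D :: "('p, 'b, 'y) cat_scheme" and N :: "('p, 'b) monoidal_data"
    and F :: "('o, 'a, 'p, 'b) funct" and \<mu> :: "'o \<Rightarrow> 'o \<Rightarrow> 'b" and e :: 'b +
  assumes mult_hom: "\<lbrakk>a \<in> Ob C; b \<in> Ob C\<rbrakk> \<Longrightarrow>
      \<mu> a b \<in> Hom D (tensor_ob N (fob F a) (fob F b)) (fob F (tensor_ob M a b))"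
    and mult_iso: "\<lbrakk>a \<in> Ob C; b \<in> Ob C\<rbrakk> \<Longrightarrow> iso_arrow D (\<mu> a b)"
    and mult_natural: "\<lbrakk>f \<in> Hom C a a'; g \<in> Hom C b b'\<rbrakk> \<Longrightarrow>
      \<mu> a' b' \<cdot>\<^bsub>D\<^esub> tensor_arr N (farr F f) (farr F g) = farr F (tensor_arr M f g) \<cdot>\<^bsub>D\<^esub> \<mu> a b"
    and unit_hom: "e \<in> Hom D (tensor_unit N) (fob F (tensor_unit M))"
    and unit_iso: "iso_arrow D e"
    and mult_assoc: "\<lbrakk>a \<in> Ob C; b \<in> Ob C; c \<in> Ob C\<rbrakk> \<Longrightarrow>
      farr F (associator M a b c)
        \<cdot>\<^bsub>D\<^esub> (\<mu> (tensor_ob M a b) c \<cdot>\<^bsub>D\<^esub> tensor_arr N (\<mu> a b) (Ident D (fob F c)))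
      = \<mu> a (tensor_ob M b c)
        \<cdot>\<^bsub>D\<^esub> (tensor_arr N (Ident D (fob F a)) (\<mu> b c)
             \<cdot>\<^bsub>D\<^esub> associator N (fob F a) (fob F b) (fob F c))"
    and mult_left_unit: "a \<in> Ob C \<Longrightarrow>
      farr F (left_unitor M a)
        \<cdot>\<^bsub>D\<^esub> (\<mu> (tensor_unit M) a \<cdot>\<^bsub>D\<^esub> tensor_arr N e (Ident D (fob F a)))
      = left_unitor N (fob F a)"
    and mult_right_unit: "a \<in> Ob C \<Longrightarrow>
      farr F (right_unitor M a)
        \<cdot>\<^bsub>D\<^esub> (\<mu> a (tensor_unit M) \<cdot>\<^bsub>D\<^esub> tensor_arr N (Ident D (fob F a)) e)
      = right_unitor N (fob F a)"
    and mult_braiding: "\<lbrakk>a \<in> Ob C; b \<in> Ob C\<rbrakk> \<Longrightarrow>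
      farr F (braiding M a b) \<cdot>\<^bsub>D\<^esub> \<mu> a b = \<mu> b a \<cdot>\<^bsub>D\<^esub> braiding N (fob F a) (fob F b)"


section \<open>Coefficient systems on a category of spaces\<close>

text \<open>
  \<open>coef_cat S X\<close> is $\mathcal C(X)$; \<open>pull S f\<close> and \<open>push S f\<close> are $f^*$ and $f_*$.
  \<open>open_compl S\<close> consists of the pairs $(i, j)$ with $j$ the open complement of
  the closed immersion $i$.  The categories $\mathcal C(X)$ share their object and arrow types,
  but not their sets of objects and arrows.
\<close>

record ('s, 'm, 'o, 'a) coef_system =
  spaces :: "('s, 'm) cat"
  closed_imm :: "'m set"
  open_compl :: "('m \<times> 'm) set"
  proper_mor :: "'m set"
  coef_cat :: "'s \<Rightarrow> ('o, 'a) tricat"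
  coef_mon :: "'s \<Rightarrow> ('o, 'a) monoidal_data"
  pull :: "'m \<Rightarrow> ('o, 'a, 'o, 'a) funct"
  push :: "'m \<Rightarrow> ('o, 'a, 'o, 'a) funct"
  pp_unit :: "'m \<Rightarrow> 'o \<Rightarrow> 'a"
  pp_counit :: "'m \<Rightarrow> 'o \<Rightarrow> 'a"
  pull_commute :: "'m \<Rightarrow> 'o \<Rightarrow> 'a"
  push_commute :: "'m \<Rightarrow> 'o \<Rightarrow> 'a"
  pull_mult :: "'m \<Rightarrow> 'o \<Rightarrow> 'o \<Rightarrow> 'a"
  pull_one :: "'m \<Rightarrow> 'a"

locale coefficient_system = spaces: category "spaces S"
  for S :: "('s, 'm, 'o, 'a) coef_system" +
  assumes closed_imm_arr: "closed_imm S \<subseteq> Arr (spaces S)"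
    and proper_mor_arr: "proper_mor S \<subseteq> Arr (spaces S)"
    and open_compl_arr: "(i, j) \<in> open_compl S \<Longrightarrow>
      i \<in> closed_imm S \<and> j \<in> Arr (spaces S) \<and> Cod (spaces S) j = Cod (spaces S) i"
    and coef_triangulated: "X \<in> Ob (spaces S) \<Longrightarrow> triangulated_category (coef_cat S X)"
    and coef_monoidal: "X \<in> Ob (spaces S) \<Longrightarrow>
      symmetric_monoidal_category (coef_cat S X) (coef_mon S X)"
    and pull_exact: "f \<in> Hom (spaces S) X Y \<Longrightarrow>
      exact_functor (coef_cat S Y) (coef_cat S X) (pull S f) (pull_commute S f)"
    and push_exact: "f \<in> Hom (spaces S) X Y \<Longrightarrow>
      exact_functor (coef_cat S X) (coef_cat S Y) (push S f) (push_commute S f)"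
    and pull_push_adj: "f \<in> Hom (spaces S) X Y \<Longrightarrow>
      adjunction (coef_cat S Y) (coef_cat S X) (pull S f) (push S f) (pp_unit S f) (pp_counit S f)"
    and pull_monoidal: "f \<in> Hom (spaces S) X Y \<Longrightarrow>
      symmetric_monoidal_functor (coef_cat S Y) (coef_mon S Y) (coef_cat S X) (coef_mon S X)
        (pull S f) (pull_mult S f) (pull_one S f)"


section \<open>Recollement\<close>

text \<open>
  \<open>conn_shriek M\<close> $: i_*i^*M \to (j_!j^*M)[1]$ and \<open>conn_star M\<close> $: j_*j^*M \to (i_*i^!M)[1]$
  are the third maps of the two functorial triangles.
\<close>

record ('o, 'a) recollement_data =
  i_shriek :: "('o, 'a, 'o, 'a) funct"
  i_shriek_unit :: "'o \<Rightarrow> 'a"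
  i_shriek_counit :: "'o \<Rightarrow> 'a"
  j_shriek :: "('o, 'a, 'o, 'a) funct"
  j_shriek_unit :: "'o \<Rightarrow> 'a"
  j_shriek_counit :: "'o \<Rightarrow> 'a"
  conn_shriek :: "'o \<Rightarrow> 'a"
  conn_star :: "'o \<Rightarrow> 'a"

locale recollement =
  fixes S :: "('s, 'm, 'o, 'a) coef_system" and i j :: 'm
    and R :: "('o, 'a) recollement_data"
    and CX CZ CU :: "('o, 'a) tricat"
  defines CX_def: "CX \<equiv> coef_cat S (Cod (spaces S) i)"
    and CZ_def: "CZ \<equiv> coef_cat S (Dom (spaces S) i)"
    and CU_def: "CU \<equiv> coef_cat S (Dom (spaces S) j)"
  assumes i_pull_push: "adjunction CX CZ (pull S i) (push S i) (pp_unit S i) (pp_counit S i)"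
    and i_push_shriek:
      "adjunction CZ CX (push S i) (i_shriek R) (i_shriek_unit R) (i_shriek_counit R)"
    and j_shriek_pull:
      "adjunction CU CX (j_shriek R) (pull S j) (j_shriek_unit R) (j_shriek_counit R)"
    and j_pull_push: "adjunction CX CU (pull S j) (push S j) (pp_unit S j) (pp_counit S j)"
    and i_push_ff: "fully_faithful CZ CX (push S i)"
    and j_shriek_ff: "fully_faithful CU CX (j_shriek R)"
    and j_pull_i_push: "M \<in> Ob CZ \<Longrightarrow> zero_object CU (fob (pull S j \<circ>\<^sub>F push S i) M)"
    and i_pull_j_shriek: "M \<in> Ob CU \<Longrightarrow> zero_object CZ (fob (pull S i \<circ>\<^sub>F j_shriek R) M)"
    and conn_shriek_natural:
      "nat_trans CX CX (push S i \<circ>\<^sub>F pull S i) (Shift CX \<circ>\<^sub>F j_shriek R \<circ>\<^sub>F pull S j) (conn_shriek R)"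
    and shriek_triangle: "M \<in> Ob CX \<Longrightarrow>
      (j_shriek_counit R M, pp_unit S i M, conn_shriek R M) \<in> Dist CX"
    and conn_star_natural:
      "nat_trans CX CX (push S j \<circ>\<^sub>F pull S j) (Shift CX \<circ>\<^sub>F push S i \<circ>\<^sub>F i_shriek R) (conn_star R)"
    and star_triangle: "M \<in> Ob CX \<Longrightarrow>
      (i_shriek_counit R M, pp_unit S j M, conn_star R M) \<in> Dist CX"


section \<open>Cohomology, cohomology with support, and the maps between them\<close>

definition cohom :: "('s, 'm, 'o, 'a) coef_system \<Rightarrow> 's \<Rightarrow> int \<Rightarrow> 'o \<Rightarrow> 'a monoid" where
  "cohom S X d A =
     hom_group (coef_cat S X) (tensor_unit (coef_mon S X)) (shift_ob (coef_cat S X) d A)"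

definition cohom_map ::
    "('s, 'm, 'o, 'a) coef_system \<Rightarrow> 's \<Rightarrow> int \<Rightarrow> 'a \<Rightarrow> 'a \<Rightarrow> 'a" where
  "cohom_map S X d g = (\<lambda>x. shift_arr (coef_cat S X) d g \<cdot>\<^bsub>coef_cat S X\<^esub> x)"

definition supp_cohom :: "('s, 'm, 'o, 'a) coef_system \<Rightarrow> 'm \<Rightarrow> ('o, 'a) recollement_data \<Rightarrow>
    int \<Rightarrow> 'o \<Rightarrow> 'a monoid" where
  "supp_cohom S i R d A =
     cohom S (Cod (spaces S) i) d (fob (push S i \<circ>\<^sub>F i_shriek R) A)"

definition supp_cohom_map :: "('s, 'm, 'o, 'a) coef_system \<Rightarrow> 'm \<Rightarrow> ('o, 'a) recollement_data \<Rightarrow>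
    int \<Rightarrow> 'a \<Rightarrow> 'a \<Rightarrow> 'a" where
  "supp_cohom_map S i R d g =
     cohom_map S (Cod (spaces S) i) d (farr (push S i \<circ>\<^sub>F i_shriek R) g)"

definition forg :: "('s, 'm, 'o, 'a) coef_system \<Rightarrow> 'm \<Rightarrow> ('o, 'a) recollement_data \<Rightarrow>
    int \<Rightarrow> 'o \<Rightarrow> 'a \<Rightarrow> 'a" where
  "forg S i R d A = cohom_map S (Cod (spaces S) i) d (i_shriek_counit R A)"

text \<open>
  The identification
  $\mathrm{Hom}(\mathbf 1_X, (j_*B)[d]) \cong \mathrm{Hom}(\mathbf 1_X, j_*(B[d]))
    \cong \mathrm{Hom}(j^*\mathbf 1_X, B[d]) \cong \mathrm{Hom}(\mathbf 1_U, B[d])$.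
\<close>

definition push_ident ::
    "('s, 'm, 'o, 'a) coef_system \<Rightarrow> 'm \<Rightarrow> int \<Rightarrow> 'o \<Rightarrow> 'a \<Rightarrow> 'a" where
  "push_ident S j d B =
     (let CU = coef_cat S (Dom (spaces S) j); CX = coef_cat S (Cod (spaces S) j) in
      (\<lambda>x. (pp_counit S j (shift_ob CU d B)
            \<cdot>\<^bsub>CU\<^esub> farr (pull S j)
                 (inv_arrow CX (commute_shift CX CU (push S j) (push_commute S j) d B) \<cdot>\<^bsub>CX\<^esub> x))
           \<cdot>\<^bsub>CU\<^esub> pull_one S j))"

definition restr :: "('s, 'm, 'o, 'a) coef_system \<Rightarrow> 'm \<Rightarrow> int \<Rightarrow> 'o \<Rightarrow> 'a \<Rightarrow> 'a" where
  "restr S j d A = (\<lambda>x. push_ident S j d (fob (pull S j) A)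
     (cohom_map S (Cod (spaces S) j) d (pp_unit S j A) x))"

definition connecting :: "('s, 'm, 'o, 'a) coef_system \<Rightarrow> 'm \<Rightarrow> 'm \<Rightarrow>
    ('o, 'a) recollement_data \<Rightarrow> int \<Rightarrow> 'o \<Rightarrow> 'a \<Rightarrow> 'a" where
  "connecting S i j R d A =
     (let X = Cod (spaces S) i; CX = coef_cat S X in
      (\<lambda>y. shift_succ CX d (fob (push S i \<circ>\<^sub>F i_shriek R) A)
        \<cdot>\<^bsub>CX\<^esub> cohom_map S X d (conn_star R A)
              (inv_into (carrier (cohom S X d (fob (push S j \<circ>\<^sub>F pull S j) A)))
                 (push_ident S j d (fob (pull S j) A)) y)))"


section \<open>Functors to abelian groups\<close>

definition ab_functor ::
    "('o, 'a, 'z) cat_scheme \<Rightarrow> ('o \<Rightarrow> 'g monoid) \<Rightarrow> ('a \<Rightarrow> 'g \<Rightarrow> 'g) \<Rightarrow> bool" where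
  "ab_functor C G \<gamma> \<longleftrightarrow>
     (\<forall>A\<in>Ob C. comm_group (G A)) \<and>
     (\<forall>A B. \<forall>g\<in>Hom C A B. \<gamma> g \<in> hom (G A) (G B)) \<and>
     (\<forall>A\<in>Ob C. \<forall>x\<in>carrier (G A). \<gamma> (Ident C A) x = x) \<and>
     (\<forall>A B D. \<forall>g\<in>Hom C A B. \<forall>h\<in>Hom C B D. \<forall>x\<in>carrier (G A). \<gamma> (h \<cdot>\<^bsub>C\<^esub> g) x = \<gamma> h (\<gamma> g x))"

definition ab_natural ::
    "('o, 'a, 'z) cat_scheme \<Rightarrow> ('o \<Rightarrow> 'g monoid) \<Rightarrow> ('a \<Rightarrow> 'g \<Rightarrow> 'g) \<Rightarrow>
      ('o \<Rightarrow> 'h monoid) \<Rightarrow> ('a \<Rightarrow> 'h \<Rightarrow> 'h) \<Rightarrow> ('o \<Rightarrow> 'g \<Rightarrow> 'h) \<Rightarrow> bool" where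
  "ab_natural C G \<gamma> H \<theta> t \<longleftrightarrow>
     (\<forall>A\<in>Ob C. t A \<in> hom (G A) (H A)) \<and>
     (\<forall>A B. \<forall>g\<in>Hom C A B. \<forall>x\<in>carrier (G A). t B (\<gamma> g x) = \<theta> g (t A x))"

end

(*
  A distinguished triangle stays exact under Hom(t, -) for every t, and so do its rotations
  (signs do not affect exactness).  "Exact under Hom(t, -) for all t" is a property of
  composable pairs that right adjoints of additive functors preserve; as the shift is an
  equivalence, both it and its quasi-inverse are such right adjoints, so the property passes
  to all shifts [d], without the sign conventions of shifted triangles.  Applied to
  i_* i^! A -> A -> j_* j^* A this gives the long exact sequence with H^d(X; j_* j^* A) in
  place of H^d(U; j^* A), and these are identified, naturally in A, by the adjunction of
  j^* and j_*, monoidality of j^* and the isomorphism (j_* B)[d] = j_* (B[d]).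
*)
theory Submission
  imports Defs
begin


section \<open>Isomorphisms and commutative squares\<close>

text \<open>Exactness at the unit object alone would not survive a shift: transposing along an
  adjunction replaces the test object t by its image under the left adjoint, which is why every t
  has to be tested. Since \<open>Shift\<close> is only an autoequivalence, a negative [d] is a power
  of \<open>Unshift\<close>, and for d < 0 the objects (B[1])[d] and B[d+1] are merely isomorphic,
  through the inverse of \<open>shift_unit\<close>. The connecting map therefore contains the
  correction \<open>shift_succ\<close>, and exactness at H_Z^{d+1} rests on its naturality, which
  matches f[1] shifted by d with f[d+1] for the counit f of the triangle. The commutation of j_*
  with [d] is likewise built separately for powers of \<open>Shift\<close> and of
  \<open>Unshift\<close>. Functoriality in A comes from writing each map as a composite of natural
  families, the inverse of the identification being one of them.\<close>

context category
begin

lemma Hom_ob: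
  assumes "f \<in> Hom C a b"
  shows "a \<in> Ob C" "b \<in> Ob C"
  using assms dom_closed cod_closed unfolding Hom_def by auto

lemma iso_arrowI:
  assumes "f \<in> Hom C a b" "g \<in> Hom C b a" "g \<cdot> f = Ident C a" "f \<cdot> g = Ident C b"
  shows "iso_arrow C f"
  using assms unfolding iso_arrow_def inverse_arrows_def Hom_def by auto

text \<open>\<open>inv_arrow\<close> is a definite description, so uniqueness comes first: two
  inverses satisfy g' = g' (f g) = (g' f) g = g.\<close>

lemma inv_arrow:
  assumes "iso_arrow C f" and f: "f \<in> Hom C a b"
  shows "inv_arrow C f \<in> Hom C b a"
    and "inv_arrow C f \<cdot> f = Ident C a"
    and "f \<cdot> inv_arrow C f = Ident C b"
proof -
  obtain g where g: "inverse_arrows C f g"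
    using assms(1) unfolding iso_arrow_def by blast
  have "g' = g" if g': "inverse_arrows C f g'" for g'
  proof -
    have h: "g \<in> Hom C b a" "g' \<in> Hom C b a"
      using f g g' unfolding inverse_arrows_def Hom_def by auto
    have "g' = g' \<cdot> (f \<cdot> g)"
      using comp_ident[OF h(2)] f g unfolding inverse_arrows_def Hom_def by auto
    also have "\<dots> = (g' \<cdot> f) \<cdot> g"
      by (simp add: comp_assoc[OF h(1) f h(2)])
    also have "\<dots> = g"
      using ident_comp[OF h(1)] f g' unfolding inverse_arrows_def Hom_def by auto
    finally show ?thesis .
  qed
  then have "inv_arrow C f = g"
    unfolding inv_arrow_def using the_equality[of "inverse_arrows C f", OF g] by blast
  then show "inv_arrow C f \<in> Hom C b a" "inv_arrow C f \<cdot> f = Ident C a"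
      "f \<cdot> inv_arrow C f = Ident C b"
    using g f unfolding inverse_arrows_def Hom_def by auto
qed

lemma iso_ident: "a \<in> Ob C \<Longrightarrow> iso_arrow C (Ident C a)"
  using iso_arrowI[OF ident_hom ident_hom comp_ident[OF ident_hom] comp_ident[OF ident_hom]] .

lemma iso_inv_arrow:
  assumes "iso_arrow C f" "f \<in> Hom C a b"
  shows "iso_arrow C (inv_arrow C f)"
  using iso_arrowI[of "inv_arrow C f" b a f] inv_arrow[OF assms] assms(2) by blast

lemma comp_inv_cancel:
  assumes "iso_arrow C f" and f: "f \<in> Hom C b c"
  shows "x \<in> Hom C a b \<Longrightarrow> inv_arrow C f \<cdot> (f \<cdot> x) = x"
    and "x \<in> Hom C a c \<Longrightarrow> f \<cdot> (inv_arrow C f \<cdot> x) = x"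
    and "y \<in> Hom C c a \<Longrightarrow> (y \<cdot> f) \<cdot> inv_arrow C f = y"
    and "y \<in> Hom C b a \<Longrightarrow> (y \<cdot> inv_arrow C f) \<cdot> f = y"
proof -
  note i = inv_arrow[OF assms]
  show "inv_arrow C f \<cdot> (f \<cdot> x) = x" if x: "x \<in> Hom C a b"
    using comp_assoc[OF x f i(1)] i(2) ident_comp[OF x] by simp
  show "f \<cdot> (inv_arrow C f \<cdot> x) = x" if x: "x \<in> Hom C a c"
    using comp_assoc[OF x i(1) f] i(3) ident_comp[OF x] by simp
  show "(y \<cdot> f) \<cdot> inv_arrow C f = y" if y: "y \<in> Hom C c a"
    using comp_assoc[OF i(1) f y] i(3) comp_ident[OF y] by simp
  show "(y \<cdot> inv_arrow C f) \<cdot> f = y" if y: "y \<in> Hom C b a"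
    using comp_assoc[OF f i(1) y] i(2) comp_ident[OF y] by simp
qed

lemma iso_comp:
  assumes "iso_arrow C f" "f \<in> Hom C a b" "iso_arrow C g" "g \<in> Hom C b c"
  shows "iso_arrow C (g \<cdot> f)"
proof -
  note f = inv_arrow[OF assms(1,2)] and g = inv_arrow[OF assms(3,4)]
  have "(inv_arrow C f \<cdot> inv_arrow C g) \<cdot> (g \<cdot> f) = Ident C a"
    using comp_assoc[OF comp_hom[OF assms(2,4)] g(1) f(1)] comp_inv_cancel(1)[OF assms(3,4,2)] f(2)
    by simp
  moreover have "(g \<cdot> f) \<cdot> (inv_arrow C f \<cdot> inv_arrow C g) = Ident C c"
    using comp_assoc[OF comp_hom[OF g(1) f(1)] assms(2,4)] comp_inv_cancel(2)[OF assms(1,2) g(1)] g(3)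
    by simp
  ultimately show ?thesis
    using assms f g by (intro iso_arrowI[of _ a c]) (auto intro: comp_hom)
qed

lemma bij_betw_iso_comp:
  assumes "iso_arrow C f" "f \<in> Hom C b c"
  shows "bij_betw (\<lambda>x. f \<cdot> x) (Hom C a b) (Hom C a c)"
  using comp_inv_cancel(1,2)[OF assms] inv_arrow(1)[OF assms] assms(2)
  by (intro bij_betwI[where g = "\<lambda>x. inv_arrow C f \<cdot> x"]) (auto intro: comp_hom)

lemma bij_betw_comp_iso:
  assumes "iso_arrow C f" "f \<in> Hom C a b"
  shows "bij_betw (\<lambda>x. x \<cdot> f) (Hom C b c) (Hom C a c)"
  using comp_inv_cancel(3,4)[OF assms] inv_arrow(1)[OF assms] assms(2)
  by (intro bij_betwI[where g = "\<lambda>x. x \<cdot> inv_arrow C f"]) (auto intro: comp_hom)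

lemma square_paste:
  assumes "p \<in> Hom C a b" "q \<in> Hom C a' b'" "p' \<in> Hom C b c" "q' \<in> Hom C b' c'"
    and "u \<in> Hom C a a'" "v \<in> Hom C b b'" "w \<in> Hom C c c'"
    and "q \<cdot> u = v \<cdot> p" "q' \<cdot> v = w \<cdot> p'"
  shows "(q' \<cdot> q) \<cdot> u = w \<cdot> (p' \<cdot> p)"
  using comp_assoc[OF assms(5,2,4)] comp_assoc[OF assms(1,6,4)] comp_assoc[OF assms(1,3,7)] assms(8,9)
  by metis

text \<open>Insert p p^-1 behind v, use the square, cancel q^-1 q. Invertible natural families thus
  have natural inverses.\<close>

lemma square_inv:
  assumes "iso_arrow C p" and p: "p \<in> Hom C a b" and "iso_arrow C q" and q: "q \<in> Hom C a' b'"
    and u: "u \<in> Hom C a a'" and v: "v \<in> Hom C b b'" and sq: "q \<cdot> u = v \<cdot> p"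
  shows "inv_arrow C q \<cdot> v = u \<cdot> inv_arrow C p"
proof -
  note p' = inv_arrow[OF assms(1) p] and q' = inv_arrow[OF assms(3) q]
  have "inv_arrow C q \<cdot> v = inv_arrow C q \<cdot> ((v \<cdot> p) \<cdot> inv_arrow C p)"
    by (simp add: comp_inv_cancel(3)[OF assms(1) p v])
  also have "\<dots> = inv_arrow C q \<cdot> (q \<cdot> (u \<cdot> inv_arrow C p))"
    using sq comp_assoc[OF p'(1) u q] by simp
  also have "\<dots> = u \<cdot> inv_arrow C p"
    using comp_inv_cancel(1)[OF assms(3) q comp_hom[OF p'(1) u]] .
  finally show ?thesis .
qed

lemma is_functor_id: "is_functor C C id_funct"
  by unfold_locales (auto simp: id_funct_def)

end

context is_functor
begin

lemma farr_iso:
  assumes "iso_arrow C f" "f \<in> Hom C a b"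
  shows "iso_arrow D (farr F f)"
proof -
  note i = source.inv_arrow[OF assms] and ob = source.Hom_ob[OF assms(2)]
  show ?thesis
    using farr_comp[OF assms(2) i(1)] farr_comp[OF i(1) assms(2)] i(2,3) ob
    by (intro target.iso_arrowI[OF farr_hom[OF assms(2)] farr_hom[OF i(1)]]) (simp_all add: farr_ident)
qed

lemma farr_square:
  assumes "p \<in> Hom C a b" "q \<in> Hom C a' b'" "u \<in> Hom C a a'" "v \<in> Hom C b b'"
    and "q \<cdot>\<^bsub>C\<^esub> u = v \<cdot>\<^bsub>C\<^esub> p"
  shows "farr F q \<cdot>\<^bsub>D\<^esub> farr F u = farr F v \<cdot>\<^bsub>D\<^esub> farr F p"
  using farr_comp[OF assms(3,2)] farr_comp[OF assms(1,4)] assms(5) by simp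

end

section \<open>Composites and powers of functors, natural isomorphisms and whiskering\<close>

lemma is_functor_comp:
  assumes "is_functor C D F" "is_functor D E G"
  shows "is_functor C E (G \<circ>\<^sub>F F)"
proof -
  interpret F: is_functor C D F by fact
  interpret G: is_functor D E G by fact
  show ?thesis
  proof
    show "fob (G \<circ>\<^sub>F F) a \<in> Ob E" if "a \<in> Ob C" for a
      using G.fob_closed[OF F.fob_closed[OF that]] by (simp add: comp_funct_def)
    show "farr (G \<circ>\<^sub>F F) f \<in> Hom E (fob (G \<circ>\<^sub>F F) a) (fob (G \<circ>\<^sub>F F) b)"
      if "f \<in> Hom C a b" for f a b
      using G.farr_hom[OF F.farr_hom[OF that]] by (simp add: comp_funct_def)
    show "farr (G \<circ>\<^sub>F F) (Ident C a) = Ident E (fob (G \<circ>\<^sub>F F) a)" if "a \<in> Ob C" for a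
      using F.farr_ident[OF that] G.farr_ident[OF F.fob_closed[OF that]]
      by (simp add: comp_funct_def)
    show "farr (G \<circ>\<^sub>F F) (g \<cdot>\<^bsub>C\<^esub> f) = farr (G \<circ>\<^sub>F F) g \<cdot>\<^bsub>E\<^esub> farr (G \<circ>\<^sub>F F) f"
      if "f \<in> Hom C a b" "g \<in> Hom C b c" for f g a b c
      using F.farr_comp[OF that] G.farr_comp[OF that[THEN F.farr_hom]]
      by (simp add: comp_funct_def)
  qed
qed

lemma comp_funct_assoc: "(H \<circ>\<^sub>F G) \<circ>\<^sub>F F = H \<circ>\<^sub>F G \<circ>\<^sub>F F"
  by (simp add: comp_funct_def comp_assoc)

lemma comp_funct_id: "F \<circ>\<^sub>F id_funct = F" "id_funct \<circ>\<^sub>F F = F"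
  by (cases F; simp add: comp_funct_def id_funct_def comp_def)+

lemma funct_simps:
  "fob (G \<circ>\<^sub>F F) a = fob G (fob F a)" "farr (G \<circ>\<^sub>F F) f = farr G (farr F f)"
  "fob id_funct a = a" "farr id_funct f = f"
  by (simp_all add: comp_funct_def id_funct_def)

text \<open>Packing both iterates as a functor makes whiskering and composition of natural
  isomorphisms available for them.\<close>

definition funct_pow :: "('o, 'a, 'o, 'a) funct \<Rightarrow> nat \<Rightarrow> ('o, 'a, 'o, 'a) funct" where
  "funct_pow F n = \<lparr>fob = fob F ^^ n, farr = farr F ^^ n\<rparr>"

lemma funct_pow_0: "funct_pow F 0 = id_funct"
  by (simp add: funct_pow_def id_funct_def id_def)

lemma funct_pow_Suc: "funct_pow F (Suc n) = F \<circ>\<^sub>F funct_pow F n"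
  by (simp add: funct_pow_def comp_funct_def)

text \<open>The factor split off on the right is the one applied first; in this form a power meets a
  \<open>Shift\<close> applied before it.\<close>

lemma funct_pow_Suc_right: "funct_pow F (Suc n) = funct_pow F n \<circ>\<^sub>F F"
  by (simp add: funct_pow_def comp_funct_def funpow_Suc_right del: funpow.simps)

lemma is_functor_funct_pow:
  assumes "is_functor C C F"
  shows "is_functor C C (funct_pow F n)"
proof (induction n)
  case 0
  interpret is_functor C C F by fact
  show ?case using source.is_functor_id by (simp only: funct_pow_0)
next
  case (Suc n)
  show ?case using is_functor_comp[OF Suc assms] by (simp only: funct_pow_Suc)
qed

lemma (in is_functor) nat_iso_ident: "nat_iso C D F F (\<lambda>a. Ident D (fob F a))"
proof
  show "Ident D (fob F a) \<in> Hom D (fob F a) (fob F a)" "iso_arrow D (Ident D (fob F a))"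
    if "a \<in> Ob C" for a
    using fob_closed[OF that] by (simp_all add: target.ident_hom target.iso_ident)
  show "Ident D (fob F b) \<cdot>\<^bsub>D\<^esub> farr F f = farr F f \<cdot>\<^bsub>D\<^esub> Ident D (fob F a)"
    if "f \<in> Hom C a b" for f a b
    using farr_hom[OF that] by (simp add: target.ident_comp target.comp_ident)
qed

lemma (in nat_iso) nat_iso_inv: "nat_iso C D G F (\<lambda>a. inv_arrow D (t a))"
proof
  show "inv_arrow D (t a) \<in> Hom D (fob G a) (fob F a)" if "a \<in> Ob C" for a
    using source.target.inv_arrow(1)[OF component_iso component, OF that that] .
  show "iso_arrow D (inv_arrow D (t a))" if "a \<in> Ob C" for a
    using source.target.iso_inv_arrow[OF component_iso component, OF that that] .
  show "inv_arrow D (t b) \<cdot>\<^bsub>D\<^esub> farr G f = farr F f \<cdot>\<^bsub>D\<^esub> inv_arrow D (t a)"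
    if f: "f \<in> Hom C a b" for f a b
  proof -
    have a: "a \<in> Ob C" and b: "b \<in> Ob C"
      using source.source.Hom_ob[OF f] by auto
    show ?thesis
      using source.target.square_inv[OF component_iso[OF a] component[OF a] component_iso[OF b]
        component[OF b] source.farr_hom[OF f] target.farr_hom[OF f] naturality[OF f]] .
  qed
qed

lemma nat_iso_comp:
  assumes "nat_iso C D F G s" "nat_iso C D G H t"
  shows "nat_iso C D F H (\<lambda>a. t a \<cdot>\<^bsub>D\<^esub> s a)"
proof -
  interpret s: nat_iso C D F G s by fact
  interpret t: nat_iso C D G H t by fact
  show ?thesis
  proof
    show "t a \<cdot>\<^bsub>D\<^esub> s a \<in> Hom D (fob F a) (fob H a)" if "a \<in> Ob C" for a
      using s.component t.component that by (blast intro: s.source.target.comp_hom)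
    show "iso_arrow D (t a \<cdot>\<^bsub>D\<^esub> s a)" if "a \<in> Ob C" for a
      using s.source.target.iso_comp[OF s.component_iso s.component t.component_iso t.component] that
      by blast
    show "(t b \<cdot>\<^bsub>D\<^esub> s b) \<cdot>\<^bsub>D\<^esub> farr F f = farr H f \<cdot>\<^bsub>D\<^esub> (t a \<cdot>\<^bsub>D\<^esub> s a)"
      if f: "f \<in> Hom C a b" for f a b
    proof -
      have a: "a \<in> Ob C" and b: "b \<in> Ob C"
        using s.source.source.Hom_ob[OF f] by auto
      show ?thesis
        using s.source.target.square_paste[OF s.component[OF a] s.component[OF b] t.component[OF a]
          t.component[OF b] s.source.farr_hom[OF f] s.target.farr_hom[OF f] t.target.farr_hom[OF f]
          s.naturality[OF f] t.naturality[OF f]] .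
    qed
  qed
qed

lemma nat_trans_whisker_left:
  assumes "nat_trans C D F G t" "is_functor D E H"
  shows "nat_trans C E (H \<circ>\<^sub>F F) (H \<circ>\<^sub>F G) (\<lambda>a. farr H (t a))"
proof -
  interpret t: nat_trans C D F G t by fact
  interpret H: is_functor D E H by fact
  interpret HF: is_functor C E "H \<circ>\<^sub>F F" by (rule is_functor_comp) unfold_locales
  interpret HG: is_functor C E "H \<circ>\<^sub>F G" by (rule is_functor_comp) unfold_locales
  show ?thesis
  proof
    show "farr H (t a) \<in> Hom E (fob (H \<circ>\<^sub>F F) a) (fob (H \<circ>\<^sub>F G) a)" if "a \<in> Ob C" for a
      using H.farr_hom[OF t.component[OF that]] by (simp add: funct_simps)
    show "farr H (t b) \<cdot>\<^bsub>E\<^esub> farr (H \<circ>\<^sub>F F) f = farr (H \<circ>\<^sub>F G) f \<cdot>\<^bsub>E\<^esub> farr H (t a)"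
      if f: "f \<in> Hom C a b" for f a b
    proof -
      have a: "a \<in> Ob C" and b: "b \<in> Ob C"
        using t.source.source.Hom_ob[OF f] by auto
      show ?thesis
        using H.farr_square[OF t.component[OF a] t.component[OF b] t.source.farr_hom[OF f]
          t.target.farr_hom[OF f] t.naturality[OF f]] by (simp add: funct_simps)
    qed
  qed
qed

lemma nat_iso_whisker_left:
  assumes "nat_iso C D F G t" "is_functor D E H"
  shows "nat_iso C E (H \<circ>\<^sub>F F) (H \<circ>\<^sub>F G) (\<lambda>a. farr H (t a))"
proof -
  interpret t: nat_iso C D F G t by fact
  interpret Ht: nat_trans C E "H \<circ>\<^sub>F F" "H \<circ>\<^sub>F G" "\<lambda>a. farr H (t a)"
    by (rule nat_trans_whisker_left[OF t.nat_trans_axioms assms(2)])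
  show ?thesis
    by unfold_locales (use is_functor.farr_iso[OF assms(2) t.component_iso t.component] in blast)
qed

lemma nat_iso_whisker_right:
  assumes "nat_iso C D F G t" "is_functor B C K"
  shows "nat_iso B D (F \<circ>\<^sub>F K) (G \<circ>\<^sub>F K) (\<lambda>a. t (fob K a))"
proof -
  interpret t: nat_iso C D F G t by fact
  interpret K: is_functor B C K by fact
  interpret FK: is_functor B D "F \<circ>\<^sub>F K" by (rule is_functor_comp) unfold_locales
  interpret GK: is_functor B D "G \<circ>\<^sub>F K" by (rule is_functor_comp) unfold_locales
  show ?thesis
    by unfold_locales
      (simp_all add: funct_simps t.component t.component_iso t.naturality[OF K.farr_hom] K.fob_closed)
qed


section \<open>Adjunctions\<close>

context adjunction
begin

text \<open>The adjunction bijection Hom(a, G b) -> Hom(F a, b), written through the counit because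
  \<open>push_ident\<close> contains this very composite.\<close>

definition transpose :: "'p \<Rightarrow> 'a \<Rightarrow> 'b" where
  "transpose b x = \<epsilon> b \<cdot>\<^bsub>D\<^esub> farr F x"

lemma unit_hom: "a \<in> Ob C \<Longrightarrow> \<eta> a \<in> Hom C a (fob G (fob F a))"
  using unit.component by (simp add: funct_simps)

lemma counit_hom: "b \<in> Ob D \<Longrightarrow> \<epsilon> b \<in> Hom D (fob F (fob G b)) b"
  using counit.component by (simp add: funct_simps)

lemma transpose_hom:
  assumes "b \<in> Ob D" "x \<in> Hom C a (fob G b)"
  shows "transpose b x \<in> Hom D (fob F a) b"
  unfolding transpose_def
  by (rule left.target.comp_hom[OF left.farr_hom[OF assms(2)] counit_hom[OF assms(1)]])

text \<open>Naturality of the counit. It lets kernel and image conditions cross the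
  adjunction.\<close>

lemma transpose_natural:
  assumes p: "p \<in> Hom D b b'" and x: "x \<in> Hom C a (fob G b)"
  shows "transpose b' (farr G p \<cdot>\<^bsub>C\<^esub> x) = p \<cdot>\<^bsub>D\<^esub> transpose b x"
proof -
  have b: "b \<in> Ob D" "b' \<in> Ob D"
    using left.target.Hom_ob[OF p] .
  note Fx = left.farr_hom[OF x] and Gp = right.farr_hom[OF p]
  have "transpose b' (farr G p \<cdot>\<^bsub>C\<^esub> x) = (\<epsilon> b' \<cdot>\<^bsub>D\<^esub> farr F (farr G p)) \<cdot>\<^bsub>D\<^esub> farr F x"
    unfolding transpose_def left.farr_comp[OF x Gp]
    by (simp add: left.target.comp_assoc[OF Fx left.farr_hom[OF Gp] counit_hom[OF b(2)]])
  also have "\<epsilon> b' \<cdot>\<^bsub>D\<^esub> farr F (farr G p) = p \<cdot>\<^bsub>D\<^esub> \<epsilon> b"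
    using counit.naturality[OF p] by (simp add: funct_simps)
  finally show ?thesis
    unfolding transpose_def by (simp add: left.target.comp_assoc[OF Fx counit_hom[OF b(1)] p])
qed

text \<open>The inverse sends y to G y after the unit at a; each triangle identity yields one of the
  two cancellations.\<close>

lemma bij_betw_transpose:
  assumes a: "a \<in> Ob C" and b: "b \<in> Ob D"
  shows "bij_betw (transpose b) (Hom C a (fob G b)) (Hom D (fob F a) b)"
proof (rule bij_betwI[where g = "\<lambda>y. farr G y \<cdot>\<^bsub>C\<^esub> \<eta> a"])
  note \<eta> = unit_hom and \<epsilon> = counit_hom
  note Gb = right.fob_closed[OF b] and Fa = left.fob_closed[OF a]
  show "transpose b \<in> Hom C a (fob G b) \<rightarrow> Hom D (fob F a) b"
    using transpose_hom[OF b] by blast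
  show "(\<lambda>y. farr G y \<cdot>\<^bsub>C\<^esub> \<eta> a) \<in> Hom D (fob F a) b \<rightarrow> Hom C a (fob G b)"
    using \<eta>[OF a] by (auto intro: left.source.comp_hom right.farr_hom)
  show "farr G (transpose b x) \<cdot>\<^bsub>C\<^esub> \<eta> a = x" if x: "x \<in> Hom C a (fob G b)" for x
  proof -
    note Fx = left.farr_hom[OF x]
    have "farr G (transpose b x) \<cdot>\<^bsub>C\<^esub> \<eta> a = farr G (\<epsilon> b) \<cdot>\<^bsub>C\<^esub> (farr G (farr F x) \<cdot>\<^bsub>C\<^esub> \<eta> a)"
      using right.farr_comp[OF Fx \<epsilon>[OF b]]
        left.source.comp_assoc[OF \<eta>[OF a] right.farr_hom[OF Fx] right.farr_hom[OF \<epsilon>[OF b]]]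
      by (simp add: transpose_def)
    also have "farr G (farr F x) \<cdot>\<^bsub>C\<^esub> \<eta> a = \<eta> (fob G b) \<cdot>\<^bsub>C\<^esub> x"
      using unit.naturality[OF x] by (simp add: funct_simps)
    also have "farr G (\<epsilon> b) \<cdot>\<^bsub>C\<^esub> (\<eta> (fob G b) \<cdot>\<^bsub>C\<^esub> x) = x"
      using left.source.comp_assoc[OF x \<eta>[OF Gb] right.farr_hom[OF \<epsilon>[OF b]]]
        triangle_right[OF b] left.source.ident_comp[OF x] by simp
    finally show ?thesis .
  qed
  show "transpose b (farr G y \<cdot>\<^bsub>C\<^esub> \<eta> a) = y" if y: "y \<in> Hom D (fob F a) b" for y
    using transpose_natural[OF y \<eta>[OF a]] triangle_left[OF a] left.target.comp_ident[OF y]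
    by (simp add: transpose_def)
qed

text \<open>On Hom(a, b), F is postcomposition with the unit at b followed by transposition, and
  both are bijective once the unit is invertible. For \<open>Shift\<close> this allows arrows to be
  desuspended.\<close>

lemma left_fully_faithful:
  assumes iso: "\<And>a. a \<in> Ob C \<Longrightarrow> iso_arrow C (\<eta> a)"
  shows "fully_faithful C D F"
  unfolding fully_faithful_def
proof (intro ballI)
  fix a b assume a: "a \<in> Ob C" and b: "b \<in> Ob C"
  note Fb = left.fob_closed[OF b]
  have "bij_betw (transpose (fob F b) \<circ> (\<lambda>x. \<eta> b \<cdot>\<^bsub>C\<^esub> x)) (Hom C a b) (Hom D (fob F a) (fob F b))"
    by (rule bij_betw_trans[OF left.source.bij_betw_iso_comp[OF iso[OF b] unit_hom[OF b]]
          bij_betw_transpose[OF a Fb]])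
  also have "?this \<longleftrightarrow> bij_betw (farr F) (Hom C a b) (Hom D (fob F a) (fob F b))"
  proof (rule bij_betw_cong)
    fix x assume x: "x \<in> Hom C a b"
    show "(transpose (fob F b) \<circ> (\<lambda>x. \<eta> b \<cdot>\<^bsub>C\<^esub> x)) x = farr F x"
      using left.farr_comp[OF x unit_hom[OF b]] triangle_left[OF b] left.target.ident_comp[OF left.farr_hom[OF x]]
        left.target.comp_assoc[OF left.farr_hom[OF x] left.farr_hom[OF unit_hom[OF b]] counit_hom[OF Fb]]
      by (simp add: transpose_def)
  qed
  finally show "bij_betw (farr F) (Hom C a b) (Hom D (fob F a) (fob F b))" .
qed

text \<open>In an adjoint equivalence the left adjoint is also right adjoint to its partner, so
  whatever right adjoints preserve is preserved by \<open>Shift\<close> as well as by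
  \<open>Unshift\<close>.\<close>

lemma equivalence_swap:
  assumes unit_iso: "\<And>a. a \<in> Ob C \<Longrightarrow> iso_arrow C (\<eta> a)"
    and counit_iso: "\<And>b. b \<in> Ob D \<Longrightarrow> iso_arrow D (\<epsilon> b)"
  shows "adjunction D C G F (\<lambda>b. inv_arrow D (\<epsilon> b)) (\<lambda>a. inv_arrow C (\<eta> a))"
proof -
  interpret \<eta>: nat_iso C C id_funct "G \<circ>\<^sub>F F" \<eta> by unfold_locales (rule unit_iso)
  interpret \<epsilon>: nat_iso D D "F \<circ>\<^sub>F G" id_funct \<epsilon> by unfold_locales (rule counit_iso)
  interpret \<eta>': nat_iso C C "G \<circ>\<^sub>F F" id_funct "\<lambda>a. inv_arrow C (\<eta> a)" by (rule \<eta>.nat_iso_inv)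
  interpret \<epsilon>': nat_iso D D id_funct "F \<circ>\<^sub>F G" "\<lambda>b. inv_arrow D (\<epsilon> b)" by (rule \<epsilon>.nat_iso_inv)
  have \<epsilon>i: "inv_arrow D (\<epsilon> b) \<in> Hom D b (fob F (fob G b))"
    and \<epsilon>l: "inv_arrow D (\<epsilon> b) \<cdot>\<^bsub>D\<^esub> \<epsilon> b = Ident D (fob F (fob G b))"
    and \<epsilon>r: "\<epsilon> b \<cdot>\<^bsub>D\<^esub> inv_arrow D (\<epsilon> b) = Ident D b" if "b \<in> Ob D" for b
    using left.target.inv_arrow[OF counit_iso counit_hom, OF that that] .
  have \<eta>i: "inv_arrow C (\<eta> a) \<in> Hom C (fob G (fob F a)) a"
    and \<eta>l: "inv_arrow C (\<eta> a) \<cdot>\<^bsub>C\<^esub> \<eta> a = Ident C a"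
    and \<eta>r: "\<eta> a \<cdot>\<^bsub>C\<^esub> inv_arrow C (\<eta> a) = Ident C (fob G (fob F a))" if "a \<in> Ob C" for a
    using left.source.inv_arrow[OF unit_iso unit_hom, OF that that] .
  show ?thesis
  proof
    fix b assume b: "b \<in> Ob D"
    note Gb = right.fob_closed[OF b]
    note hG = right.farr_hom[OF \<epsilon>i[OF b]] right.farr_hom[OF counit_hom[OF b]]
    \<comment> \<open>Expanding by a triangle identity shows that G of the inverse counit is the
      unit at G b; the required identity is then an inverse law.\<close>
    have "farr G (inv_arrow D (\<epsilon> b)) = farr G (inv_arrow D (\<epsilon> b)) \<cdot>\<^bsub>C\<^esub> (farr G (\<epsilon> b) \<cdot>\<^bsub>C\<^esub> \<eta> (fob G b))"
      using triangle_right[OF b] left.source.comp_ident[OF hG(1)] by simp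
    also have "\<dots> = farr G (inv_arrow D (\<epsilon> b) \<cdot>\<^bsub>D\<^esub> \<epsilon> b) \<cdot>\<^bsub>C\<^esub> \<eta> (fob G b)"
      using right.farr_comp[OF counit_hom[OF b] \<epsilon>i[OF b]]
        left.source.comp_assoc[OF unit_hom[OF Gb] hG(2,1)] by simp
    also have "\<dots> = \<eta> (fob G b)"
      using \<epsilon>l[OF b] right.farr_ident[OF left.fob_closed[OF Gb]]
        left.source.ident_comp[OF unit_hom[OF Gb]] by simp
    finally show "inv_arrow C (\<eta> (fob G b)) \<cdot>\<^bsub>C\<^esub> farr G (inv_arrow D (\<epsilon> b)) = Ident C (fob G b)"
      using \<eta>l[OF Gb] by simp
  next
    fix a assume a: "a \<in> Ob C"
    note Fa = left.fob_closed[OF a]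
    note hF = left.farr_hom[OF \<eta>i[OF a]] left.farr_hom[OF unit_hom[OF a]]
    \<comment> \<open>The other triangle identity shows that F of the inverse unit is the counit at
      F a.\<close>
    have "farr F (inv_arrow C (\<eta> a)) = (\<epsilon> (fob F a) \<cdot>\<^bsub>D\<^esub> farr F (\<eta> a)) \<cdot>\<^bsub>D\<^esub> farr F (inv_arrow C (\<eta> a))"
      using triangle_left[OF a] left.target.ident_comp[OF hF(1)] by simp
    also have "\<dots> = \<epsilon> (fob F a) \<cdot>\<^bsub>D\<^esub> farr F (\<eta> a \<cdot>\<^bsub>C\<^esub> inv_arrow C (\<eta> a))"
      using left.farr_comp[OF \<eta>i[OF a] unit_hom[OF a]]
        left.target.comp_assoc[OF hF counit_hom[OF Fa]] by simp
    also have "\<dots> = \<epsilon> (fob F a)"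
      using \<eta>r[OF a] left.farr_ident[OF right.fob_closed[OF Fa]]
        left.target.comp_ident[OF counit_hom[OF Fa]] by simp
    finally show "farr F (inv_arrow C (\<eta> a)) \<cdot>\<^bsub>D\<^esub> inv_arrow D (\<epsilon> (fob F a)) = Ident D (fob F a)"
      using \<epsilon>r[OF Fa] by simp
  qed
qed

end


section \<open>Hom groups\<close>

lemma hom_group_simps [simp]:
  "carrier (hom_group C a b) = Hom C a b" "mult (hom_group C a b) = Add C"
  "one (hom_group C a b) = Zero C a b"
  by (simp_all add: hom_group_def)

context additive_category
begin

lemma hom_group_group: "\<lbrakk>a \<in> Ob C; b \<in> Ob C\<rbrakk> \<Longrightarrow> group (hom_group C a b)"
  using hom_comm_group comm_group.axioms(2) by blast

lemma Zero_hom: "\<lbrakk>a \<in> Ob C; b \<in> Ob C\<rbrakk> \<Longrightarrow> Zero C a b \<in> Hom C a b"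
  using monoid.one_closed[OF group.is_monoid[OF hom_group_group]] by fastforce

lemma Add_hom:
  assumes "f \<in> Hom C a b" "g \<in> Hom C a b"
  shows "Add C f g \<in> Hom C a b"
  using monoid.m_closed[OF group.is_monoid[OF hom_group_group]] Hom_ob[OF assms(1)] assms by fastforce

lemma postcomp_hom:
  assumes "g \<in> Hom C b c"
  shows "(\<lambda>x. g \<cdot> x) \<in> hom (hom_group C t b) (hom_group C t c)"
  using assms by (intro homI) (auto intro: comp_hom simp: comp_add)

lemma precomp_hom:
  assumes "f \<in> Hom C a b"
  shows "(\<lambda>x. x \<cdot> f) \<in> hom (hom_group C b c) (hom_group C a c)"
  using assms by (intro homI) (auto intro: comp_hom simp: add_comp)

lemma comp_Zero:
  assumes "g \<in> Hom C b c" "t \<in> Ob C"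
  shows "g \<cdot> Zero C t b = Zero C t c"
  using hom_one[OF postcomp_hom hom_group_group hom_group_group, OF assms(1,2) _ assms(2)]
    Hom_ob[OF assms(1)] by simp

lemma Zero_comp:
  assumes "f \<in> Hom C a b" "c \<in> Ob C"
  shows "Zero C b c \<cdot> f = Zero C a c"
  using hom_one[OF precomp_hom hom_group_group hom_group_group, OF assms(1) _ assms(2) _ assms(2)]
    Hom_ob[OF assms(1)] by simp

lemma Neg_hom:
  assumes f: "f \<in> Hom C a b"
  shows "Neg C f \<in> Hom C a b"
  using group.inv_closed[OF hom_group_group[OF Hom_ob[OF f]]] f by (auto simp: Neg_def Hom_def)

lemma Neg_comp:
  assumes x: "x \<in> Hom C t b" and g: "g \<in> Hom C b c"
  shows "Neg C g \<cdot> x = Neg C (g \<cdot> x)"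
proof -
  interpret group_hom "hom_group C b c" "hom_group C t c" "\<lambda>y. y \<cdot> x"
    using hom_group_group precomp_hom[OF x] Hom_ob[OF x] Hom_ob[OF g]
    by (simp add: group_hom_def group_hom_axioms_def)
  show ?thesis
    using hom_inv[of g] g comp_hom[OF x g] by (auto simp: Neg_def Hom_def)
qed

lemma comp_Neg:
  assumes x: "x \<in> Hom C t b" and g: "g \<in> Hom C b c"
  shows "g \<cdot> Neg C x = Neg C (g \<cdot> x)"
proof -
  interpret group_hom "hom_group C t b" "hom_group C t c" "\<lambda>y. g \<cdot> y"
    using hom_group_group postcomp_hom[OF g] Hom_ob[OF x] Hom_ob[OF g]
    by (simp add: group_hom_def group_hom_axioms_def)
  show ?thesis
    using hom_inv[of x] x comp_hom[OF x g] by (auto simp: Neg_def Hom_def)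
qed

lemma Neg_Neg:
  assumes f: "f \<in> Hom C a b"
  shows "Neg C (Neg C f) = f"
  using group.inv_inv[OF hom_group_group[OF Hom_ob[OF f]], of f] Neg_hom[OF f] f
  by (simp add: Neg_def Hom_def)

lemma Neg_eq_Zero_iff:
  assumes f: "f \<in> Hom C a b"
  shows "Neg C f = Zero C a b \<longleftrightarrow> f = Zero C a b"
  using group.inv_eq_1_iff[OF hom_group_group[OF Hom_ob[OF f]], of f] f
  by (simp add: Neg_def Hom_def)

end

lemma additive_functor_hom:
  assumes "additive_functor C D F"
  shows "farr F \<in> hom (hom_group C a b) (hom_group D (fob F a) (fob F b))"
proof -
  interpret additive_functor C D F by fact
  show ?thesis
    by (intro homI) (auto intro: farr_hom simp: farr_add)
qed

lemma additive_functor_Zero: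
  assumes "additive_category C" "additive_category D" "additive_functor C D F"
    and "a \<in> Ob C" "b \<in> Ob C"
  shows "farr F (Zero C a b) = Zero D (fob F a) (fob F b)"
proof -
  interpret C: additive_category C by fact
  interpret D: additive_category D by fact
  interpret F: additive_functor C D F by fact
  show ?thesis
    using hom_one[OF additive_functor_hom[OF assms(3)] C.hom_group_group[OF assms(4,5)]
        D.hom_group_group[OF assms(4,5)[THEN F.fob_closed]]] by simp
qed

text \<open>The kernel-image condition is kept as a statement on arrows for all t, since adjunctions
  move t; only at the end is it read at the unit, as exactness of groups.\<close>

definition hom_exact ::
    "('o, 'a, 'z) tricat_scheme \<Rightarrow> 'o \<Rightarrow> 'o \<Rightarrow> 'o \<Rightarrow> 'a \<Rightarrow> 'a \<Rightarrow> bool" where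
  "hom_exact C a b c f g \<longleftrightarrow> f \<in> Hom C a b \<and> g \<in> Hom C b c \<and>
     (\<forall>t\<in>Ob C. \<forall>x\<in>Hom C t b. g \<cdot>\<^bsub>C\<^esub> x = Zero C t c \<longleftrightarrow> (\<exists>y\<in>Hom C t a. f \<cdot>\<^bsub>C\<^esub> y = x))"

lemma hom_exactI:
  assumes "f \<in> Hom C a b" "g \<in> Hom C b c"
    and "\<And>t x. \<lbrakk>t \<in> Ob C; x \<in> Hom C t b\<rbrakk> \<Longrightarrow>
      g \<cdot>\<^bsub>C\<^esub> x = Zero C t c \<longleftrightarrow> (\<exists>y\<in>Hom C t a. f \<cdot>\<^bsub>C\<^esub> y = x)"
  shows "hom_exact C a b c f g"
  using assms unfolding hom_exact_def by blast

lemma hom_exactD: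
  assumes "hom_exact C a b c f g"
  shows "f \<in> Hom C a b" "g \<in> Hom C b c"
    and "\<lbrakk>t \<in> Ob C; x \<in> Hom C t b\<rbrakk> \<Longrightarrow>
      g \<cdot>\<^bsub>C\<^esub> x = Zero C t c \<longleftrightarrow> (\<exists>y\<in>Hom C t a. f \<cdot>\<^bsub>C\<^esub> y = x)"
  using assms unfolding hom_exact_def by blast+

lemma (in additive_category) hom_exact_kernel:
  assumes "hom_exact C a b c f g" "t \<in> Ob C"
  shows "kernel (hom_group C t b) (hom_group C t c) (\<lambda>x. g \<cdot> x) = (\<lambda>x. f \<cdot> x) ` Hom C t a"
  using hom_exactD[OF assms(1)] assms(2) by (auto simp: kernel_def intro: comp_hom)

text \<open>A sign does not change which composites vanish; this removes the one that rotation puts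
  on the shifted first map.\<close>

lemma (in additive_category) hom_exact_Neg:
  assumes "hom_exact C a b c f (Neg C g)" and g: "g \<in> Hom C b c"
  shows "hom_exact C a b c f g"
proof (rule hom_exactI[OF hom_exactD(1)[OF assms(1)] g])
  fix t x assume t: "t \<in> Ob C" and x: "x \<in> Hom C t b"
  show "g \<cdot> x = Zero C t c \<longleftrightarrow> (\<exists>y\<in>Hom C t a. f \<cdot> y = x)"
    using hom_exactD(3)[OF assms(1) t x] Neg_comp[OF x g] Neg_eq_Zero_iff[OF comp_hom[OF x g]]
    by simp
qed

lemma (in additive_category) iso_comp_eq_Zero_iff:
  assumes s: "iso_arrow C s" "s \<in> Hom C c d" and x: "x \<in> Hom C t c"
  shows "s \<cdot> x = Zero C t d \<longleftrightarrow> x = Zero C t c"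
proof -
  note ob = Hom_ob[OF x]
  show ?thesis
    using inj_on_eq_iff[OF bij_betw_imp_inj_on[OF bij_betw_iso_comp[OF s]] x Zero_hom[OF ob]]
      comp_Zero[OF s(2) ob(1)] by simp
qed

text \<open>Serves to replace the target (a[1])[n] of a shifted connecting map by a[n+1]; composing
  with s creates no new zeros.\<close>

lemma (in additive_category) hom_exact_iso_right:
  assumes ex: "hom_exact C a b c f g" and s: "iso_arrow C s" "s \<in> Hom C c d"
  shows "hom_exact C a b d f (s \<cdot> g)"
proof (rule hom_exactI)
  note fg = hom_exactD(1,2)[OF ex]
  show "f \<in> Hom C a b" "s \<cdot> g \<in> Hom C b d"
    using fg s(2) by (auto intro: comp_hom)
  fix t x assume t: "t \<in> Ob C" and x: "x \<in> Hom C t b"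
  show "(s \<cdot> g) \<cdot> x = Zero C t d \<longleftrightarrow> (\<exists>y\<in>Hom C t a. f \<cdot> y = x)"
    unfolding comp_assoc[OF x fg(2) s(2)] iso_comp_eq_Zero_iff[OF s comp_hom[OF x fg(2)]]
    by (rule hom_exactD(3)[OF ex t x])
qed

text \<open>The same replacement when (a[1])[n] is the middle object: the square identifies k' with
  k up to isomorphism, and x factors through s h exactly when s^-1 x factors through h.\<close>

lemma (in additive_category) hom_exact_iso_left:
  assumes sh: "hom_exact C b c d h k"
    and s: "iso_arrow C s" "s \<in> Hom C c c'" and s': "iso_arrow C s'" "s' \<in> Hom C d d'"
    and k': "k' \<in> Hom C c' d'" and sq: "k' \<cdot> s = s' \<cdot> k"
  shows "hom_exact C b c' d' (s \<cdot> h) k'"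
proof (rule hom_exactI)
  note h = hom_exactD(1,2)[OF sh] and si = inv_arrow[OF s]
  show "s \<cdot> h \<in> Hom C b c'" "k' \<in> Hom C c' d'"
    using comp_hom[OF h(1) s(2)] k' by auto
  fix t x assume t: "t \<in> Ob C" and x: "x \<in> Hom C t c'"
  let ?x = "inv_arrow C s \<cdot> x"
  note x' = comp_hom[OF x si(1)]
  have "k' \<cdot> x = s' \<cdot> (k \<cdot> ?x)"
    using comp_inv_cancel(2)[OF s x] comp_assoc[OF x' s(2) k'] comp_assoc[OF x' h(2) s'(2)] sq by simp
  then have "k' \<cdot> x = Zero C t d' \<longleftrightarrow> (\<exists>y\<in>Hom C t b. h \<cdot> y = ?x)"
    using hom_exactD(3)[OF sh t x'] iso_comp_eq_Zero_iff[OF s' comp_hom[OF x' h(2)]] by simp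
  also have "\<dots> \<longleftrightarrow> (\<exists>y\<in>Hom C t b. (s \<cdot> h) \<cdot> y = x)"
  proof (rule bex_cong[OF refl])
    fix y assume y: "y \<in> Hom C t b"
    show "h \<cdot> y = ?x \<longleftrightarrow> (s \<cdot> h) \<cdot> y = x"
      using comp_assoc[OF y h(1) s(2)] comp_inv_cancel(1)[OF s comp_hom[OF y h(1)]]
        comp_inv_cancel(2)[OF s x] by metis
  qed
  finally show "k' \<cdot> x = Zero C t d' \<longleftrightarrow> (\<exists>y\<in>Hom C t b. (s \<cdot> h) \<cdot> y = x)" .
qed

text \<open>Transposition is bijective, commutes with postcomposition and preserves zero, so the
  condition for (G p, G q) at t is the condition for (p, q) at F t.\<close>

lemma right_adjoint_hom_exact:
  assumes adj: "adjunction C D F G \<eta> \<epsilon>"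
    and C: "additive_category C" and D: "additive_category D" and F: "additive_functor C D F"
    and ex: "hom_exact D a b c p q"
  shows "hom_exact C (fob G a) (fob G b) (fob G c) (farr G p) (farr G q)"
proof (rule hom_exactI)
  interpret C: additive_category C by fact
  interpret D: additive_category D by fact
  interpret adjunction C D F G \<eta> \<epsilon> by fact
  note pq = hom_exactD(1,2)[OF ex]
  note ob = D.Hom_ob[OF pq(1)] D.Hom_ob[OF pq(2)]
  show "farr G p \<in> Hom C (fob G a) (fob G b)" "farr G q \<in> Hom C (fob G b) (fob G c)"
    using pq by (auto intro: right.farr_hom)
  fix t x assume t: "t \<in> Ob C" and x: "x \<in> Hom C t (fob G b)"
  note Gc = right.fob_closed[OF ob(4)] and Ft = left.fob_closed[OF t]
  note bij = bij_betw_transpose[OF t]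
  \<comment> \<open>Additivity of F enters here: it sends zero arrows to zero arrows.\<close>
  have "transpose c (Zero C t (fob G c)) = Zero D (fob F t) c"
    using additive_functor_Zero[OF C D F t Gc] D.comp_Zero[OF counit_hom[OF ob(4)] Ft]
    by (simp add: transpose_def)
  then have "farr G q \<cdot>\<^bsub>C\<^esub> x = Zero C t (fob G c) \<longleftrightarrow> q \<cdot>\<^bsub>D\<^esub> transpose b x = Zero D (fob F t) c"
    using inj_on_eq_iff[OF bij_betw_imp_inj_on[OF bij[OF ob(4)]]
        C.comp_hom[OF x right.farr_hom[OF pq(2)]] C.Zero_hom[OF t Gc]]
      transpose_natural[OF pq(2) x] by simp
  also have "\<dots> \<longleftrightarrow> (\<exists>y\<in>Hom D (fob F t) a. p \<cdot>\<^bsub>D\<^esub> y = transpose b x)"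
    by (rule hom_exactD(3)[OF ex Ft transpose_hom[OF ob(2) x]])
  \<comment> \<open>Surjectivity: every y from F t to a is itself a transpose.\<close>
  also have "\<dots> \<longleftrightarrow> (\<exists>y\<in>Hom C t (fob G a). p \<cdot>\<^bsub>D\<^esub> transpose a y = transpose b x)"
    unfolding bij_betw_imp_surj_on[OF bij[OF ob(1)], symmetric] by simp
  also have "\<dots> \<longleftrightarrow> (\<exists>y\<in>Hom C t (fob G a). farr G p \<cdot>\<^bsub>C\<^esub> y = x)"
  proof (rule bex_cong[OF refl])
    fix y assume y: "y \<in> Hom C t (fob G a)"
    show "p \<cdot>\<^bsub>D\<^esub> transpose a y = transpose b x \<longleftrightarrow> farr G p \<cdot>\<^bsub>C\<^esub> y = x"
      using inj_on_eq_iff[OF bij_betw_imp_inj_on[OF bij[OF ob(2)]]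
          C.comp_hom[OF y right.farr_hom[OF pq(1)]] x] transpose_natural[OF pq(1) y] by simp
  qed
  finally show "farr G q \<cdot>\<^bsub>C\<^esub> x = Zero C t (fob G c)
      \<longleftrightarrow> (\<exists>y\<in>Hom C t (fob G a). farr G p \<cdot>\<^bsub>C\<^esub> y = x)" .
qed

text \<open>Additivity can be checked after transposition, which is injective: G h transposes to h
  after the transpose of the identity, and this depends additively on h.\<close>

lemma right_adjoint_additive:
  assumes adj: "adjunction C D F G \<eta> \<epsilon>"
    and C: "additive_category C" and D: "additive_category D" and F: "additive_functor C D F"
  shows "additive_functor D C G"
proof -
  interpret C: additive_category C by fact
  interpret D: additive_category D by fact
  interpret adjunction C D F G \<eta> \<epsilon> by fact
  interpret F: additive_functor C D F by fact
  show ?thesis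
  proof
    fix f g b b' assume f: "f \<in> Hom D b b'" and g: "g \<in> Hom D b b'"
    note ob = D.Hom_ob[OF f]
    note Gb = right.fob_closed[OF ob(1)]
    let ?i = "Ident C (fob G b)"
    note i = C.ident_hom[OF Gb] and G = right.farr_hom[OF f] right.farr_hom[OF g]
    note S = C.Add_hom[OF G]
    have tr: "transpose b' (farr G h) = h \<cdot>\<^bsub>D\<^esub> transpose b ?i" if "h \<in> Hom D b b'" for h
      using transpose_natural[OF that i] C.comp_ident[OF right.farr_hom[OF that]] by simp
    have "transpose b' (Add C (farr G f) (farr G g))
        = Add D (transpose b' (farr G f)) (transpose b' (farr G g))"
      using F.farr_add[OF G] D.comp_add[OF left.farr_hom[OF G(1)] left.farr_hom[OF G(2)] counit_hom[OF ob(2)]]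
      by (simp add: transpose_def)
    also have "\<dots> = Add D f g \<cdot>\<^bsub>D\<^esub> transpose b ?i"
      using tr[OF f] tr[OF g] D.add_comp[OF transpose_hom[OF ob(1) i] f g] by simp
    also have "\<dots> = transpose b' (farr G (Add D f g))"
      using tr[OF D.Add_hom[OF f g]] by simp
    finally show "farr G (Add D f g) = Add C (farr G f) (farr G g)"
      using inj_on_eq_iff[OF bij_betw_imp_inj_on[OF bij_betw_transpose[OF Gb ob(2)]]
          S right.farr_hom[OF D.Add_hom[OF f g]]] by simp
  qed
qed


section \<open>Triangulated categories\<close>

context triangulated_category
begin

lemma shift_ff:
  assumes "a \<in> Ob C" "b \<in> Ob C"
  shows "bij_betw (farr (Shift C)) (Hom C a b) (Hom C (fob (Shift C) a) (fob (Shift C) b))"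
  using shift_adj.left_fully_faithful[OF shift_unit_iso] assms unfolding fully_faithful_def by blast

text \<open>TR3 maps the triangle of the identity of a to the given one, starting with (id, f); the
  middle square factors g f through a zero object.\<close>

lemma dist_comp_Zero:
  assumes d: "(f, g, h) \<in> Dist C" and f: "f \<in> Hom C a b" and g: "g \<in> Hom C b c"
  shows "g \<cdot> f = Zero C a c"
proof -
  obtain z where z: "zero_object C z" using has_zero_object by blast
  then have zo: "z \<in> Ob C" by (simp add: zero_object_def)
  note ob = Hom_ob[OF f]
  note i = ident_hom[OF ob(1)]
  have "\<exists>w. triangle_map C (Ident C a, f, w) (Ident C a, Zero C a z, Zero C z (fob (Shift C) a)) (f, g, h)"
    by (rule TR3[OF TR1_ident[OF ob(1) z] d]) (use f i in \<open>auto simp: Hom_def\<close>)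
  then obtain w where w: "w \<in> Hom C z c" "w \<cdot> Zero C a z = g \<cdot> f"
    using Zero_hom[OF ob(1) zo] g unfolding triangle_map_def Hom_def by auto
  then show ?thesis
    using comp_Zero[OF w(1) ob(1)] by simp
qed

lemma dist_rotate:
  assumes "(f, g, h) \<in> Dist C"
  shows "(g, h, Neg C (farr (Shift C) f)) \<in> Dist C"
  using TR2[OF dist_triangle[OF assms]] assms by simp

text \<open>TR3 supplies only the third component of a map of triangles, whereas y would be a first
  component. Both triangles are therefore rotated, so that TR3 yields y[1], which full faithfulness
  of the shift brings back.\<close>

lemma dist_lift:
  assumes d: "(f, g, h) \<in> Dist C" and f: "f \<in> Hom C a b" and g: "g \<in> Hom C b c"
    and h: "h \<in> Hom C c (fob (Shift C) a)"
    and x: "x \<in> Hom C t b" and gx: "g \<cdot> x = Zero C t c"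
  shows "\<exists>y\<in>Hom C t a. f \<cdot> y = x"
proof -
  let ?S = "farr (Shift C)"
  obtain z where z: "zero_object C z" using has_zero_object by blast
  then have zo: "z \<in> Ob C" by (simp add: zero_object_def)
  note ob = Hom_ob[OF f] Hom_ob[OF g] and t = Hom_ob(1)[OF x]
  note St = shift.fob_closed[OF t] and i = ident_hom[OF t]
  \<comment> \<open>The rotated identity triangle t -> 0 -> t[1]; a map out of it may begin with x
    and the zero arrow because g x = 0.\<close>
  have tri: "(Zero C t z, Zero C z (fob (Shift C) t), Neg C (?S (Ident C t))) \<in> Dist C"
    by (rule dist_rotate[OF TR1_ident[OF t z]])
  have zt: "Zero C t z \<in> Hom C t z" "Zero C z (fob (Shift C) t) \<in> Hom C z (fob (Shift C) t)"
    "Zero C z c \<in> Hom C z c"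
    using Zero_hom t zo St ob by auto
  have "\<exists>w. triangle_map C (x, Zero C z c, w)
      (Zero C t z, Zero C z (fob (Shift C) t), Neg C (?S (Ident C t))) (g, h, Neg C (?S f))"
    by (rule TR3[OF tri dist_rotate[OF d]])
      (use x g zt gx comp_Zero[OF zt(3) t] in \<open>auto simp: Hom_def\<close>)
  then obtain w where w: "w \<in> Hom C (fob (Shift C) t) (fob (Shift C) a)"
      "?S x \<cdot> Neg C (?S (Ident C t)) = Neg C (?S f) \<cdot> w"
    using zt h unfolding triangle_map_def Hom_def by auto
  note Sx = shift.farr_hom[OF x] and Sf = shift.farr_hom[OF f]
  \<comment> \<open>Both last maps carry the rotation sign, so the third square reads -x[1] = -(f[1]
    w) and the signs cancel.\<close>
  have "Neg C (?S x) = ?S x \<cdot> Neg C (?S (Ident C t))"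
    unfolding shift.farr_ident[OF t] comp_Neg[OF ident_hom[OF St] Sx] comp_ident[OF Sx] ..
  also have "\<dots> = Neg C (?S f \<cdot> w)"
    unfolding w(2) by (rule Neg_comp[OF w(1) Sf])
  finally have "Neg C (Neg C (?S x)) = Neg C (Neg C (?S f \<cdot> w))" by (rule arg_cong)
  then have "?S x = ?S f \<cdot> w"
    unfolding Neg_Neg[OF Sx] Neg_Neg[OF comp_hom[OF w(1) Sf]] .
  \<comment> \<open>Fullness of the shift gives y with y[1] = w; faithfulness then gives f y =
    x.\<close>
  moreover obtain y where y: "y \<in> Hom C t a" "?S y = w"
    using bij_betw_imp_surj_on[OF shift_ff[OF t ob(1)]] w(1) by (metis imageE)
  ultimately have "?S (f \<cdot> y) = ?S x"
    unfolding shift.farr_comp[OF y(1) f] by metis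
  then have "f \<cdot> y = x"
    unfolding inj_on_eq_iff[OF bij_betw_imp_inj_on[OF shift_ff[OF t ob(2)]] comp_hom[OF y(1) f] x] .
  then show ?thesis using y(1) by blast
qed

lemma dist_hom_exact:
  assumes d: "(f, g, h) \<in> Dist C" and f: "f \<in> Hom C a b" and g: "g \<in> Hom C b c"
  shows "hom_exact C a b c f g"
proof (rule hom_exactI[OF f g])
  fix t x assume t: "t \<in> Ob C" and x: "x \<in> Hom C t b"
  have h: "h \<in> Hom C c (fob (Shift C) a)"
    using dist_triangle[OF d] f g unfolding is_triangle_def Hom_def by auto
  have "g \<cdot> (f \<cdot> y) = Zero C t c" if y: "y \<in> Hom C t a" for y
    using comp_assoc[OF y f g] dist_comp_Zero[OF d f g] Zero_comp[OF y Hom_ob(2)[OF g]] by simp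
  then show "g \<cdot> x = Zero C t c \<longleftrightarrow> (\<exists>y\<in>Hom C t a. f \<cdot> y = x)"
    using dist_lift[OF d f g h x] by blast
qed

text \<open>Additivity of \<open>Unshift\<close> is inherited by adjunction; it is needed when
  \<open>Unshift\<close> takes the place of the left adjoint.\<close>

lemma unshift_additive: "additive_functor C C (Unshift C)"
  using right_adjoint_additive[OF shift_adj.adjunction_axioms additive_category_axioms
    additive_category_axioms shift.additive_functor_axioms] .

lemma shift_hom_exact:
  assumes "hom_exact C a b c f g"
  shows "hom_exact C (fob (Shift C) a) (fob (Shift C) b) (fob (Shift C) c) (farr (Shift C) f) (farr (Shift C) g)"
  using right_adjoint_hom_exact[OF shift_adj.equivalence_swap[OF shift_unit_iso shift_counit_iso]
    additive_category_axioms additive_category_axioms unshift_additive assms] .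

lemma unshift_hom_exact:
  assumes "hom_exact C a b c f g"
  shows "hom_exact C (fob (Unshift C) a) (fob (Unshift C) b) (fob (Unshift C) c)
    (farr (Unshift C) f) (farr (Unshift C) g)"
  using right_adjoint_hom_exact[OF shift_adj.adjunction_axioms
    additive_category_axioms additive_category_axioms
    shift.additive_functor_axioms assms] .

lemma shift_unit_nat_iso: "nat_iso C C id_funct (Unshift C \<circ>\<^sub>F Shift C) (shift_unit C)"
  by unfold_locales (rule shift_unit_iso)

lemma shift_counit_nat_iso: "nat_iso C C (Shift C \<circ>\<^sub>F Unshift C) id_funct (shift_counit C)"
  by unfold_locales (rule shift_counit_iso)

end

section \<open>The functors [d] and the shifted exact sequence of a triangle\<close>

definition shift_funct :: "('o, 'a, 'z) tricat_scheme \<Rightarrow> int \<Rightarrow> ('o, 'a, 'o, 'a) funct" where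
  "shift_funct C d = \<lparr>fob = shift_ob C d, farr = shift_arr C d\<rparr>"

lemma shift_funct_simps:
  "fob (shift_funct C d) = shift_ob C d" "farr (shift_funct C d) = shift_arr C d"
  by (simp_all add: shift_funct_def)

lemma shift_funct_int: "shift_funct C (int n) = funct_pow (Shift C) n"
  by (simp add: shift_funct_def funct_pow_def shift_ob_def shift_arr_def)

lemma shift_funct_neg: "shift_funct C (- int n) = funct_pow (Unshift C) n"
  \<comment> \<open>For n = 0 the definition takes the branch of \<open>Shift\<close>, where both
    iterates are the identity.\<close>
  by (cases "n = 0") (simp_all add: shift_funct_def funct_pow_def shift_ob_def shift_arr_def)

context triangulated_category
begin

lemma shift_funct_functor: "is_functor C C (shift_funct C d)"
  using is_functor_funct_pow[OF shift.is_functor_axioms] is_functor_funct_pow[OF shift_adj.right.is_functor_axioms]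
  by (cases d rule: int_cases2) (simp_all add: shift_funct_int shift_funct_neg)

lemma hom_exact_shift:
  assumes "hom_exact C a b c f g"
  shows "hom_exact C (shift_ob C d a) (shift_ob C d b) (shift_ob C d c) (shift_arr C d f) (shift_arr C d g)"
proof -
  have pos: "hom_exact C ((fob (Shift C) ^^ n) a) ((fob (Shift C) ^^ n) b) ((fob (Shift C) ^^ n) c)
      ((farr (Shift C) ^^ n) f) ((farr (Shift C) ^^ n) g)" for n
    by (induction n) (use assms shift_hom_exact in auto)
  have neg: "hom_exact C ((fob (Unshift C) ^^ n) a) ((fob (Unshift C) ^^ n) b) ((fob (Unshift C) ^^ n) c)
      ((farr (Unshift C) ^^ n) f) ((farr (Unshift C) ^^ n) g)" for n
    by (induction n) (use assms unshift_hom_exact in auto)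
  show ?thesis
    using pos neg by (simp add: shift_ob_def shift_arr_def)
qed

text \<open>For d >= 0 both functors coincide. For d = -(n+1) the source is n copies of
  \<open>Unshift\<close> after one more \<open>Unshift\<close> after \<open>Shift\<close>, and the
  inverse unit cancels the last two.\<close>

lemma shift_succ_nat_iso:
  "nat_iso C C (shift_funct C d \<circ>\<^sub>F Shift C) (shift_funct C (d + 1)) (shift_succ C d)"
proof (cases d rule: int_cases)
  case (nonneg n)
  interpret T: is_functor C C "shift_funct C (d + 1)" by (rule shift_funct_functor)
  have d1: "d + 1 = int (Suc n)" using nonneg by simp
  have "shift_funct C d \<circ>\<^sub>F Shift C = shift_funct C (d + 1)"
    unfolding d1 unfolding nonneg shift_funct_int funct_pow_Suc_right ..
  moreover have "shift_succ C d = (\<lambda>a. Ident C (fob (shift_funct C (d + 1)) a))"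
    using nonneg by (simp add: fun_eq_iff shift_succ_def shift_funct_simps)
  ultimately show ?thesis
    using T.nat_iso_ident by simp
next
  case (neg n)
  have d1: "d + 1 = - int n" using neg by simp
  interpret u: nat_iso C C id_funct "Unshift C \<circ>\<^sub>F Shift C" "shift_unit C" by (rule shift_unit_nat_iso)
  have "shift_funct C (d + 1) \<circ>\<^sub>F Unshift C \<circ>\<^sub>F Shift C = shift_funct C d \<circ>\<^sub>F Shift C"
    unfolding d1 unfolding neg shift_funct_neg funct_pow_Suc_right comp_funct_assoc ..
  moreover have "shift_succ C d = (\<lambda>a. farr (shift_funct C (d + 1)) (inv_arrow C (shift_unit C a)))"
    using neg by (simp add: fun_eq_iff shift_succ_def shift_funct_simps)
  ultimately show ?thesis
    using nat_iso_whisker_left[OF u.nat_iso_inv shift_funct_functor[of "d + 1"]]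
    by (simp add: comp_funct_id)
qed

text \<open>The triangle and its rotations give three exact pairs; [n] is applied to each, and
  \<open>shift_succ\<close> then replaces (a[1])[n] by a[n+1], so that the last map is the first one
  in degree n+1.\<close>

lemma dist_long_exact:
  assumes d: "(f, g, h) \<in> Dist C" and f: "f \<in> Hom C a b" and g: "g \<in> Hom C b c"
    and h: "h \<in> Hom C c (fob (Shift C) a)"
  shows "hom_exact C (shift_ob C n a) (shift_ob C n b) (shift_ob C n c) (shift_arr C n f) (shift_arr C n g)"
    and "hom_exact C (shift_ob C n b) (shift_ob C n c) (shift_ob C (n + 1) a)
      (shift_arr C n g) (shift_succ C n a \<cdot> shift_arr C n h)"
    and "hom_exact C (shift_ob C n c) (shift_ob C (n + 1) a) (shift_ob C (n + 1) b)
      (shift_succ C n a \<cdot> shift_arr C n h) (shift_arr C (n + 1) f)"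
proof -
  note Sf = shift.farr_hom[OF f] and a = Hom_ob(1)[OF f] and b = Hom_ob(2)[OF f]
  interpret succ: nat_iso C C "shift_funct C n \<circ>\<^sub>F Shift C" "shift_funct C (n + 1)" "shift_succ C n"
    by (rule shift_succ_nat_iso)
  have succ_iso: "iso_arrow C (shift_succ C n e)"
    and succ_hom: "shift_succ C n e \<in> Hom C (shift_ob C n (fob (Shift C) e)) (shift_ob C (n + 1) e)"
    if "e \<in> Ob C" for e
    using succ.component_iso[OF that] succ.component[OF that] by (simp_all add: funct_simps shift_funct_simps)
  note E1 = hom_exact_shift[OF dist_hom_exact[OF d f g], of n]
  note E2 = hom_exact_shift[OF dist_hom_exact[OF dist_rotate[OF d] g h], of n]
  \<comment> \<open>The sign from the rotation is removed before shifting, so no compatibility of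
    [n] with negation enters.\<close>
  note E3 = hom_exact_shift[OF hom_exact_Neg[OF
        dist_hom_exact[OF dist_rotate[OF dist_rotate[OF d]] h Neg_hom[OF Sf]] Sf], of n]
  show "hom_exact C (shift_ob C n a) (shift_ob C n b) (shift_ob C n c) (shift_arr C n f) (shift_arr C n g)"
    by (rule E1)
  show "hom_exact C (shift_ob C n b) (shift_ob C n c) (shift_ob C (n + 1) a)
      (shift_arr C n g) (shift_succ C n a \<cdot> shift_arr C n h)"
    by (rule hom_exact_iso_right[OF E2 succ_iso[OF a] succ_hom[OF a]])
  \<comment> \<open>Naturality of \<open>shift_succ\<close> at f trades f[1] shifted by n for
    f[n+1].\<close>
  have "shift_arr C (n + 1) f \<cdot> shift_succ C n a = shift_succ C n b \<cdot> shift_arr C n (farr (Shift C) f)"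
    using succ.naturality[OF f] by (simp add: funct_simps shift_funct_simps)
  moreover have "shift_arr C (n + 1) f \<in> Hom C (shift_ob C (n + 1) a) (shift_ob C (n + 1) b)"
    using is_functor.farr_hom[OF shift_funct_functor f, of "n + 1"] by (simp add: shift_funct_simps)
  ultimately show "hom_exact C (shift_ob C n c) (shift_ob C (n + 1) a) (shift_ob C (n + 1) b)
      (shift_succ C n a \<cdot> shift_arr C n h) (shift_arr C (n + 1) f)"
    using hom_exact_iso_left[OF E3 succ_iso[OF a] succ_hom[OF a] succ_iso[OF b] succ_hom[OF b]] by blast
qed

end

section \<open>Exact functors commute with all shifts\<close>

lemma (in exact_functor) commute_unshift_nat_iso:
  "nat_iso C D (F \<circ>\<^sub>F Unshift C) (Unshift D \<circ>\<^sub>F F) (commute_unshift D C F \<phi>)"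
proof -
  note UD = target_tri.shift_adj.right.is_functor_axioms and UC = source_tri.shift_adj.right.is_functor_axioms
  \<comment> \<open>The part of the mate under the outer \<open>Unshift\<close>: the inverse of
    \<phi> whiskered by \<open>Unshift\<close>, then F of the counit.\<close>
  have "nat_iso C D (Shift D \<circ>\<^sub>F F \<circ>\<^sub>F Unshift C) F
      (\<lambda>a. farr F (shift_counit C a) \<cdot>\<^bsub>D\<^esub> inv_arrow D (\<phi> (fob (Unshift C) a)))"
    using nat_iso_comp[OF nat_iso_whisker_right[OF commute.nat_iso_inv UC, unfolded comp_funct_assoc]
        nat_iso_whisker_left[OF source_tri.shift_counit_nat_iso is_functor_axioms]]
    by (simp add: comp_funct_id)
  from nat_iso_whisker_left[OF this UD]
  have "nat_iso C D (Unshift D \<circ>\<^sub>F Shift D \<circ>\<^sub>F F \<circ>\<^sub>F Unshift C) (Unshift D \<circ>\<^sub>F F)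
      (\<lambda>a. farr (Unshift D) (farr F (shift_counit C a) \<cdot>\<^bsub>D\<^esub> inv_arrow D (\<phi> (fob (Unshift C) a))))" .
  \<comment> \<open>Preceding it by the shift unit of the target category completes the
    mate.\<close>
  from nat_iso_comp[OF nat_iso_whisker_right[OF target_tri.shift_unit_nat_iso
        is_functor_comp[OF UC is_functor_axioms], unfolded comp_funct_assoc comp_funct_id] this]
  show ?thesis
    by (simp add: commute_unshift_def[abs_def] funct_simps)
qed

text \<open>One step moves F past the outermost shift; the induction hypothesis, whiskered by that
  shift, moves it past the rest.\<close>

lemma (in exact_functor) commute_shift_nat_iso:
  "nat_iso C D (F \<circ>\<^sub>F shift_funct C d) (shift_funct D d \<circ>\<^sub>F F) (commute_shift D C F \<phi> d)"
proof -
  have pos: "nat_iso C D (F \<circ>\<^sub>F funct_pow (Shift C) n) (funct_pow (Shift D) n \<circ>\<^sub>F F)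
      (commute_pos D C F \<phi> n)" for n
  proof (induction n)
    case 0
    show ?case
      using nat_iso_ident by (simp add: funct_pow_0 comp_funct_id)
  next
    case (Suc n)
    note P = is_functor_funct_pow[OF source_tri.shift.is_functor_axioms, of n]
    show ?case
      using nat_iso_comp[OF nat_iso_whisker_right[OF commute.nat_iso_axioms P, unfolded comp_funct_assoc]
          nat_iso_whisker_left[OF Suc target_tri.shift.is_functor_axioms]]
      by (simp add: funct_pow_Suc comp_funct_assoc) (simp add: funct_pow_def)
  qed
  have neg: "nat_iso C D (F \<circ>\<^sub>F funct_pow (Unshift C) n) (funct_pow (Unshift D) n \<circ>\<^sub>F F)
      (commute_neg D C F \<phi> n)" for n
  proof (induction n)
    case 0
    show ?case
      using nat_iso_ident by (simp add: funct_pow_0 comp_funct_id)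
  next
    case (Suc n)
    note P = is_functor_funct_pow[OF source_tri.shift_adj.right.is_functor_axioms, of n]
    show ?case
      using nat_iso_comp[OF nat_iso_whisker_right[OF commute_unshift_nat_iso P, unfolded comp_funct_assoc]
          nat_iso_whisker_left[OF Suc target_tri.shift_adj.right.is_functor_axioms]]
      by (simp add: funct_pow_Suc comp_funct_assoc) (simp add: funct_pow_def)
  qed
  show ?thesis
  proof (cases d rule: int_cases2)
    case (nonneg n)
    then have "commute_shift D C F \<phi> d = commute_pos D C F \<phi> n"
      by (simp add: commute_shift_def)
    then show ?thesis using pos[of n] nonneg by (simp add: shift_funct_int)
  next
    case (nonpos n)
    \<comment> \<open>Degree 0 falls under the nonnegative branch of the definition; both recursions
      start at the identity.\<close>
    then have "commute_shift D C F \<phi> d = commute_neg D C F \<phi> n"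
      by (cases "n = 0") (simp_all add: commute_shift_def fun_eq_iff)
    then show ?thesis using neg[of n] nonpos by (simp add: shift_funct_neg)
  qed
qed


section \<open>Functors to abelian groups\<close>

lemma ab_functor_group: "\<lbrakk>ab_functor C G \<gamma>; A \<in> Ob C\<rbrakk> \<Longrightarrow> group (G A)"
  unfolding ab_functor_def using comm_group.axioms(2) by blast

lemma ab_natural_hom: "\<lbrakk>ab_natural C G \<gamma> H \<theta> s; A \<in> Ob C\<rbrakk> \<Longrightarrow> s A \<in> hom (G A) (H A)"
  unfolding ab_natural_def by blast

lemma ab_functor_Hom:
  assumes "is_functor C D F" "additive_category D" "t \<in> Ob D"
  shows "ab_functor C (\<lambda>A. hom_group D t (fob F A)) (\<lambda>g x. farr F g \<cdot>\<^bsub>D\<^esub> x)"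
proof -
  interpret D: additive_category D by fact
  interpret F: is_functor C D F by fact
  show ?thesis
    unfolding ab_functor_def
  proof (intro conjI allI ballI)
    show "comm_group (hom_group D t (fob F A))" if "A \<in> Ob C" for A
      by (rule D.hom_comm_group[OF assms(3) F.fob_closed[OF that]])
    show "(\<lambda>x. farr F g \<cdot>\<^bsub>D\<^esub> x) \<in> hom (hom_group D t (fob F A)) (hom_group D t (fob F B))"
      if "g \<in> Hom C A B" for g A B
      by (rule D.postcomp_hom[OF F.farr_hom[OF that]])
    show "farr F (Ident C A) \<cdot>\<^bsub>D\<^esub> x = x" if "A \<in> Ob C" "x \<in> carrier (hom_group D t (fob F A))" for A x
      using that F.farr_ident D.ident_comp by simp
    show "farr F (h \<cdot>\<^bsub>C\<^esub> g) \<cdot>\<^bsub>D\<^esub> x = farr F h \<cdot>\<^bsub>D\<^esub> (farr F g \<cdot>\<^bsub>D\<^esub> x)"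
      if "g \<in> Hom C A B" "h \<in> Hom C B E" "x \<in> carrier (hom_group D t (fob F A))" for g h x A B E
      using that F.farr_comp[OF that(1,2)] D.comp_assoc[OF _ F.farr_hom F.farr_hom, OF _ that(1,2)] by simp
  qed
qed

lemma ab_natural_Hom:
  assumes "nat_trans C D F G s" "additive_category D" "t \<in> Ob D"
  shows "ab_natural C (\<lambda>A. hom_group D t (fob F A)) (\<lambda>g x. farr F g \<cdot>\<^bsub>D\<^esub> x)
    (\<lambda>A. hom_group D t (fob G A)) (\<lambda>g x. farr G g \<cdot>\<^bsub>D\<^esub> x) (\<lambda>A x. s A \<cdot>\<^bsub>D\<^esub> x)"
proof -
  interpret D: additive_category D by fact
  interpret s: nat_trans C D F G s by fact
  show ?thesis
    unfolding ab_natural_def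
  proof (intro conjI allI ballI)
    show "(\<lambda>x. s A \<cdot>\<^bsub>D\<^esub> x) \<in> hom (hom_group D t (fob F A)) (hom_group D t (fob G A))"
      if "A \<in> Ob C" for A
      by (rule D.postcomp_hom[OF s.component[OF that]])
    fix A B g x assume g: "g \<in> Hom C A B" and "x \<in> carrier (hom_group D t (fob F A))"
    then have x: "x \<in> Hom D t (fob F A)" by simp
    have AB: "A \<in> Ob C" "B \<in> Ob C" using s.source.source.Hom_ob[OF g] .
    show "s B \<cdot>\<^bsub>D\<^esub> (farr F g \<cdot>\<^bsub>D\<^esub> x) = farr G g \<cdot>\<^bsub>D\<^esub> (s A \<cdot>\<^bsub>D\<^esub> x)"
      using D.comp_assoc[OF x s.source.farr_hom[OF g] s.component[OF AB(2)]]
        D.comp_assoc[OF x s.component[OF AB(1)] s.target.farr_hom[OF g]] s.naturality[OF g] by simp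
  qed
qed

lemma ab_natural_comp:
  assumes "ab_natural C G \<gamma> H \<theta> s" "ab_natural C H \<theta> K \<kappa> t" "category C"
  shows "ab_natural C G \<gamma> K \<kappa> (\<lambda>A x. t A (s A x))"
  unfolding ab_natural_def
proof (intro conjI allI ballI)
  show "(\<lambda>x. t A (s A x)) \<in> hom (G A) (K A)" if "A \<in> Ob C" for A
    using assms(1,2) that hom_compose[of "s A" "G A" "H A" "t A" "K A"]
    unfolding ab_natural_def comp_def by blast
  fix A B g x assume g: "g \<in> Hom C A B" and x: "x \<in> carrier (G A)"
  then have "s A x \<in> carrier (H A)"
    using assms(1) category.Hom_ob[OF assms(3) g] unfolding ab_natural_def hom_def by blast
  then show "t B (s B (\<gamma> g x)) = \<kappa> g (t A (s A x))"
    using assms(1,2) g x unfolding ab_natural_def by metis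
qed

text \<open>A family natural in B stays natural in A when B = F A; this carries
  \<open>push_ident\<close> from objects on U to restrictions from X.\<close>

lemma ab_natural_pullback:
  assumes "ab_natural D G \<gamma> H \<theta> s" "is_functor C D F"
  shows "ab_natural C (\<lambda>A. G (fob F A)) (\<lambda>g. \<gamma> (farr F g)) (\<lambda>A. H (fob F A)) (\<lambda>g. \<theta> (farr F g))
    (\<lambda>A. s (fob F A))"
  using assms(1) is_functor.fob_closed[OF assms(2)] is_functor.farr_hom[OF assms(2)]
  unfolding ab_natural_def by metis

text \<open>\<open>connecting\<close> inverts the identification by \<open>inv_into\<close>; on
  carriers this is a genuine inverse, so the naturality square can be read backwards.\<close>

lemma ab_natural_inv:
  assumes nat: "ab_natural C G \<gamma> H \<theta> s" and G: "ab_functor C G \<gamma>" and C: "category C"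
    and iso: "\<And>A. A \<in> Ob C \<Longrightarrow> s A \<in> iso (G A) (H A)"
  shows "ab_natural C H \<theta> G \<gamma> (\<lambda>A. inv_into (carrier (G A)) (s A))"
  unfolding ab_natural_def
proof (intro conjI allI ballI)
  show "inv_into (carrier (G A)) (s A) \<in> hom (H A) (G A)" if A: "A \<in> Ob C" for A
  proof -
    interpret comm_group "G A" using G A unfolding ab_functor_def by blast
    show ?thesis using iso_set_sym[OF iso[OF A]] unfolding iso_def by blast
  qed
  fix A B g y assume g: "g \<in> Hom C A B" and y: "y \<in> carrier (H A)"
  have AB: "A \<in> Ob C" "B \<in> Ob C" using category.Hom_ob[OF C g] .
  have bij: "bij_betw (s A) (carrier (G A)) (carrier (H A))" "bij_betw (s B) (carrier (G B)) (carrier (H B))"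
    using iso[OF AB(1)] iso[OF AB(2)] unfolding iso_def by blast+
  let ?x = "inv_into (carrier (G A)) (s A) y"
  have x: "?x \<in> carrier (G A)" "s A ?x = y"
    using bij(1) y unfolding bij_betw_def by (auto simp: inv_into_into f_inv_into_f)
  have "\<gamma> g ?x \<in> carrier (G B)"
    using G g x(1) unfolding ab_functor_def hom_def by blast
  moreover have "s B (\<gamma> g ?x) = \<theta> g y"
    using nat g x unfolding ab_natural_def by metis
  ultimately show "inv_into (carrier (G B)) (s B) (\<theta> g y) = \<gamma> g ?x"
    using bij(2) inv_into_f_eq[of "s B" "carrier (G B)"] unfolding bij_betw_def by metis
qed

text \<open>P is injective, so P u and u have the same kernel; the kernel of v P^-1 is the P-image
  of that of v, and its image is that of v. This lets H^d(U) take the place of a group computed on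
  X.\<close>

lemma exact_seq_transport:
  assumes grp: "group G1" "group G2" "group G3" "group G4" "group G5" "group H"
    and hom: "f \<in> hom G1 G2" "u \<in> hom G2 G3" "v \<in> hom G3 G4" "w \<in> hom G4 G5"
    and P: "P \<in> iso G3 H"
    and ex: "kernel G2 G3 u = f ` carrier G1" "kernel G3 G4 v = u ` carrier G2"
      "kernel G4 G5 w = v ` carrier G3"
  shows "exact_seq (([G1], []) \<longlongrightarrow>\<^bsub>f\<^esub> G2 \<longlongrightarrow>\<^bsub>(\<lambda>x. P (u x))\<^esub> H
    \<longlongrightarrow>\<^bsub>(\<lambda>y. v (inv_into (carrier G3) P y))\<^esub> G4 \<longlongrightarrow>\<^bsub>w\<^esub> G5)"
proof -
  let ?Q = "inv_into (carrier G3) P"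
  have bij: "inj_on P (carrier G3)" "P ` carrier G3 = carrier H" and Ph: "P \<in> hom G3 H"
    using P unfolding iso_def bij_betw_def by auto
  have Q: "?Q \<in> iso H G3" by (rule group.iso_set_sym[OF grp(3) P])
  then have Qh: "?Q \<in> hom H G3" and Qs: "?Q ` carrier H = carrier G3"
    unfolding iso_def bij_betw_def by auto
  have QP: "?Q (P z) = z" if "z \<in> carrier G3" for z
    using that bij(1) by simp
  have u: "u x \<in> carrier G3" if "x \<in> carrier G2" for x
    using hom(2) that unfolding hom_def by auto
  have P1: "P z = \<one>\<^bsub>H\<^esub> \<longleftrightarrow> z = \<one>\<^bsub>G3\<^esub>" if "z \<in> carrier G3" for z
    using inj_on_eq_iff[OF bij(1) that monoid.one_closed[OF group.is_monoid[OF grp(3)]]]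
      hom_one[OF Ph grp(3,6)] by simp
  have k2: "kernel G2 H (\<lambda>x. P (u x)) = f ` carrier G1"
    using ex(1) P1[OF u] unfolding kernel_def by auto
  have "kernel H G4 (\<lambda>y. v (?Q y)) = P ` kernel G3 G4 v"
    unfolding kernel_def bij(2)[symmetric] by (auto simp: QP)
  then have k3: "kernel H G4 (\<lambda>y. v (?Q y)) = (\<lambda>x. P (u x)) ` carrier G2"
    unfolding ex(2) image_image .
  have k4: "kernel G4 G5 w = (\<lambda>y. v (?Q y)) ` carrier H"
    using ex(3) Qs by (metis image_image)
  have h: "(\<lambda>x. P (u x)) \<in> hom G2 H" "(\<lambda>y. v (?Q y)) \<in> hom H G4"
    using hom_compose[OF hom(2) Ph] hom_compose[OF Qh hom(3)] unfolding comp_def by auto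
  show ?thesis
    using grp hom h k2 k3 k4 by (simp add: group_hom_def group_hom_axioms_def)
qed


section \<open>The long exact sequence\<close>

context coefficient_system
begin

lemma coef_additive: "X \<in> Ob (spaces S) \<Longrightarrow> additive_category (coef_cat S X)"
  by (rule triangulated_category.axioms(1)[OF coef_triangulated])

lemma unit_ob: "X \<in> Ob (spaces S) \<Longrightarrow> tensor_unit (coef_mon S X) \<in> Ob (coef_cat S X)"
  by (rule symmetric_monoidal_category.unit_closed[OF coef_monoidal])

text \<open>Coefficients F A cover all cases: the groups with support, those on X and those on U are
  all Hom out of a unit object, after F and [d].\<close>

lemma ab_functor_cohom:
  assumes "X \<in> Ob (spaces S)" "is_functor C (coef_cat S X) F"
  shows "ab_functor C (\<lambda>A. cohom S X d (fob F A)) (\<lambda>g. cohom_map S X d (farr F g))"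
  using ab_functor_Hom[OF is_functor_comp[OF assms(2)
        triangulated_category.shift_funct_functor[OF coef_triangulated[OF assms(1)], of d]]
      coef_additive[OF assms(1)] unit_ob[OF assms(1)]]
  by (simp add: cohom_def cohom_map_def funct_simps shift_funct_simps)

lemma ab_natural_cohom:
  assumes "X \<in> Ob (spaces S)" "nat_trans C (coef_cat S X) F G s"
  shows "ab_natural C (\<lambda>A. cohom S X d (fob F A)) (\<lambda>g. cohom_map S X d (farr F g))
    (\<lambda>A. cohom S X d (fob G A)) (\<lambda>g. cohom_map S X d (farr G g)) (\<lambda>A. cohom_map S X d (s A))"
  using ab_natural_Hom[OF nat_trans_whisker_left[OF assms(2)
        triangulated_category.shift_funct_functor[OF coef_triangulated[OF assms(1)], of d]]
      coef_additive[OF assms(1)] unit_ob[OF assms(1)]]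
  by (simp add: cohom_def cohom_map_def funct_simps shift_funct_simps)

section \<open>Cohomology on X of a pushforward j_* B and cohomology of B on U\<close>

context
  fixes U X :: 's and j :: 'm
  assumes j: "j \<in> Hom (spaces S) U X"
begin

interpretation U: triangulated_category "coef_cat S U"
  by (rule coef_triangulated[OF spaces.Hom_ob(1)[OF j]])

interpretation X: triangulated_category "coef_cat S X"
  by (rule coef_triangulated[OF spaces.Hom_ob(2)[OF j]])

interpretation pull: exact_functor "coef_cat S X" "coef_cat S U" "pull S j" "pull_commute S j"
  by (rule pull_exact[OF j])

interpretation push: exact_functor "coef_cat S U" "coef_cat S X" "push S j" "push_commute S j"
  by (rule push_exact[OF j])

interpretation adj: adjunction "coef_cat S X" "coef_cat S U" "pull S j" "push S j"
    "pp_unit S j" "pp_counit S j"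
  by (rule pull_push_adj[OF j])

interpretation comm: nat_iso "coef_cat S U" "coef_cat S X"
    "push S j \<circ>\<^sub>F shift_funct (coef_cat S U) d" "shift_funct (coef_cat S X) d \<circ>\<^sub>F push S j"
    "commute_shift (coef_cat S X) (coef_cat S U) (push S j) (push_commute S j) d" for d
  by (rule push.commute_shift_nat_iso)

lemma push_ident_eq:
  "push_ident S j d B = (\<lambda>x. adj.transpose (shift_ob (coef_cat S U) d B)
      (inv_arrow (coef_cat S X) (commute_shift (coef_cat S X) (coef_cat S U) (push S j) (push_commute S j) d B)
        \<cdot>\<^bsub>coef_cat S X\<^esub> x)
    \<cdot>\<^bsub>coef_cat S U\<^esub> pull_one S j)"
  using j by (simp add: push_ident_def Let_def adj.transpose_def Hom_def)

text \<open>Three bijections are composed: the inverse commutation of j_* with [d], transposition,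
  and composition with \<open>pull_one\<close>, which exchanges the source j^* 1_X for 1_U. Each is
  additive, transposition because j^* is.\<close>

lemma push_ident_iso:
  assumes B: "B \<in> Ob (coef_cat S U)"
  shows "push_ident S j d B \<in> iso (cohom S X d (fob (push S j) B)) (cohom S U d B)"
proof -
  let ?c = "commute_shift (coef_cat S X) (coef_cat S U) (push S j) (push_commute S j) d B"
  let ?T = "tensor_unit (coef_mon S X)" and ?Bd = "shift_ob (coef_cat S U) d B"
  note T = unit_ob[OF spaces.Hom_ob(2)[OF j]]
  have Bd: "?Bd \<in> Ob (coef_cat S U)"
    using is_functor.fob_closed[OF U.shift_funct_functor B] by (simp add: shift_funct_simps)
  interpret mon: symmetric_monoidal_functor "coef_cat S X" "coef_mon S X" "coef_cat S U" "coef_mon S U"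
      "pull S j" "pull_mult S j" "pull_one S j"
    by (rule pull_monoidal[OF j])
  have c: "iso_arrow (coef_cat S X) ?c"
    "?c \<in> Hom (coef_cat S X) (fob (push S j) ?Bd) (shift_ob (coef_cat S X) d (fob (push S j) B))"
    using comm.component_iso[OF B, of d] comm.component[OF B, of d]
    by (simp_all add: funct_simps shift_funct_simps)
  note ci = X.iso_inv_arrow[OF c] X.inv_arrow(1)[OF c]
  have "(\<lambda>x. inv_arrow (coef_cat S X) ?c \<cdot>\<^bsub>coef_cat S X\<^esub> x)
      \<in> iso (cohom S X d (fob (push S j) B)) (hom_group (coef_cat S X) ?T (fob (push S j) ?Bd))"
    unfolding cohom_def
    by (intro isoI X.postcomp_hom[OF ci(2)]) (simp add: X.bij_betw_iso_comp[OF ci])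
  moreover have "adj.transpose ?Bd \<in> iso (hom_group (coef_cat S X) ?T (fob (push S j) ?Bd))
      (hom_group (coef_cat S U) (fob (pull S j) ?T) ?Bd)"
  proof (rule isoI)
    show "adj.transpose ?Bd \<in> hom (hom_group (coef_cat S X) ?T (fob (push S j) ?Bd))
        (hom_group (coef_cat S U) (fob (pull S j) ?T) ?Bd)"
      using hom_compose[OF additive_functor_hom[OF pull.additive_functor_axioms]
          U.postcomp_hom[OF adj.counit_hom[OF Bd]]]
      by (simp add: comp_def adj.transpose_def[abs_def])
  qed (simp add: adj.bij_betw_transpose[OF T Bd])
  moreover have "(\<lambda>x. x \<cdot>\<^bsub>coef_cat S U\<^esub> pull_one S j)
      \<in> iso (hom_group (coef_cat S U) (fob (pull S j) ?T) ?Bd) (cohom S U d B)"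
    unfolding cohom_def
    by (intro isoI U.precomp_hom[OF mon.unit_hom])
      (simp add: U.bij_betw_comp_iso[OF mon.unit_iso mon.unit_hom])
  ultimately show ?thesis
    unfolding push_ident_eq using iso_set_trans[OF iso_set_trans] by (simp add: comp_def)
qed

text \<open>The inverse commutation and the transposition are natural in B, while
  \<open>pull_one\<close> is composed at the source, where associativity lets g[d] pass.\<close>

lemma push_ident_natural:
  "ab_natural (coef_cat S U) (\<lambda>B. cohom S X d (fob (push S j) B))
     (\<lambda>g. cohom_map S X d (farr (push S j) g)) (cohom S U d) (cohom_map S U d) (push_ident S j d)"
  unfolding ab_natural_def
proof (intro conjI allI ballI)
  show "push_ident S j d B \<in> hom (cohom S X d (fob (push S j) B)) (cohom S U d B)"
    if "B \<in> Ob (coef_cat S U)" for B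
    using push_ident_iso[OF that] unfolding iso_def by blast
  fix B B' g x
  assume g: "g \<in> Hom (coef_cat S U) B B'" and "x \<in> carrier (cohom S X d (fob (push S j) B))"
  then have x: "x \<in> Hom (coef_cat S X) (tensor_unit (coef_mon S X))
      (shift_ob (coef_cat S X) d (fob (push S j) B))"
    by (simp add: cohom_def)
  let ?ci = "\<lambda>B. inv_arrow (coef_cat S X)
    (commute_shift (coef_cat S X) (coef_cat S U) (push S j) (push_commute S j) d B)"
  let ?gd = "shift_arr (coef_cat S U) d g"
  interpret ci: nat_iso "coef_cat S U" "coef_cat S X"
      "shift_funct (coef_cat S X) d \<circ>\<^sub>F push S j" "push S j \<circ>\<^sub>F shift_funct (coef_cat S U) d" ?ci
    by (rule comm.nat_iso_inv)
  interpret mon: symmetric_monoidal_functor "coef_cat S X" "coef_mon S X" "coef_cat S U" "coef_mon S U"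
      "pull S j" "pull_mult S j" "pull_one S j"
    by (rule pull_monoidal[OF j])
  note B = U.Hom_ob[OF g]
  note simps = funct_simps shift_funct_simps
  have ci: "?ci A \<in> Hom (coef_cat S X) (shift_ob (coef_cat S X) d (fob (push S j) A))
      (fob (push S j) (shift_ob (coef_cat S U) d A))" if "A \<in> Ob (coef_cat S U)" for A
    using ci.component[OF that] by (simp add: simps)
  have gd: "?gd \<in> Hom (coef_cat S U) (shift_ob (coef_cat S U) d B) (shift_ob (coef_cat S U) d B')"
    using is_functor.farr_hom[OF U.shift_funct_functor g, of d] by (simp add: simps)
  have pg: "shift_arr (coef_cat S X) d (farr (push S j) g) \<in> Hom (coef_cat S X)
      (shift_ob (coef_cat S X) d (fob (push S j) B)) (shift_ob (coef_cat S X) d (fob (push S j) B'))"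
    using comm.target.farr_hom[OF g, of d] by (simp add: simps)
  have ppg: "farr (push S j) ?gd \<in> Hom (coef_cat S X)
      (fob (push S j) (shift_ob (coef_cat S U) d B)) (fob (push S j) (shift_ob (coef_cat S U) d B'))"
    by (rule push.farr_hom[OF gd])
  let ?y = "?ci B \<cdot>\<^bsub>coef_cat S X\<^esub> x"
  note y = X.comp_hom[OF x ci[OF B(1)]]
  have Bd: "shift_ob (coef_cat S U) d B \<in> Ob (coef_cat S U)"
    by (rule U.Hom_ob(1)[OF gd])
  \<comment> \<open>Naturality of the inverse commutation turns (j_* g)[d] into j_* (g[d]), ready
    for transposition.\<close>
  have "?ci B' \<cdot>\<^bsub>coef_cat S X\<^esub> (shift_arr (coef_cat S X) d (farr (push S j) g) \<cdot>\<^bsub>coef_cat S X\<^esub> x)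
      = farr (push S j) ?gd \<cdot>\<^bsub>coef_cat S X\<^esub> ?y"
    using ci.naturality[OF g] X.comp_assoc[OF x pg ci[OF B(2)]] X.comp_assoc[OF x ci[OF B(1)] ppg]
    by (simp add: simps)
  then have "push_ident S j d B' (cohom_map S X d (farr (push S j) g) x)
      = (?gd \<cdot>\<^bsub>coef_cat S U\<^esub> adj.transpose (shift_ob (coef_cat S U) d B) ?y) \<cdot>\<^bsub>coef_cat S U\<^esub> pull_one S j"
    using adj.transpose_natural[OF gd y] by (simp add: push_ident_eq cohom_map_def)
  also have "\<dots> = cohom_map S U d g (push_ident S j d B x)"
    using U.comp_assoc[OF mon.unit_hom adj.transpose_hom[OF Bd y] gd]
    by (simp add: push_ident_eq cohom_map_def)
  finally show "push_ident S j d B' (cohom_map S X d (farr (push S j) g) x)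
      = cohom_map S U d g (push_ident S j d B x)" .
qed

end

end

theorem theorem3p3:
  fixes S :: "('s, 'm, 'o, 'a) coef_system"
    and R :: "('o, 'a) recollement_data"
    and i j :: 'm and X Z U :: 's
  assumes "coefficient_system S"
    and "i \<in> Hom (spaces S) Z X" and "i \<in> closed_imm S"
    and "j \<in> Hom (spaces S) U X" and "(i, j) \<in> open_compl S"
    and "recollement S i j R"
  shows "(\<forall>A\<in>Ob (coef_cat S X). \<forall>d::int.
            exact_seq (([supp_cohom S i R d A], [])
              \<longlongrightarrow>\<^bsub>forg S i R d A\<^esub> cohom S X d A
              \<longlongrightarrow>\<^bsub>restr S j d A\<^esub> cohom S U d (fob (pull S j) A)
              \<longlongrightarrow>\<^bsub>connecting S i j R d A\<^esub> supp_cohom S i R (d + 1) A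
              \<longlongrightarrow>\<^bsub>forg S i R (d + 1) A\<^esub> cohom S X (d + 1) A))
       \<and> (\<forall>d::int.
            ab_functor (coef_cat S X) (supp_cohom S i R d) (supp_cohom_map S i R d)
          \<and> ab_functor (coef_cat S X) (cohom S X d) (cohom_map S X d)
          \<and> ab_functor (coef_cat S X) (\<lambda>A. cohom S U d (fob (pull S j) A))
              (\<lambda>g. cohom_map S U d (farr (pull S j) g))
          \<and> ab_natural (coef_cat S X) (supp_cohom S i R d) (supp_cohom_map S i R d)
              (cohom S X d) (cohom_map S X d) (forg S i R d)
          \<and> ab_natural (coef_cat S X) (cohom S X d) (cohom_map S X d)
              (\<lambda>A. cohom S U d (fob (pull S j) A))
              (\<lambda>g. cohom_map S U d (farr (pull S j) g)) (restr S j d)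
          \<and> ab_natural (coef_cat S X) (\<lambda>A. cohom S U d (fob (pull S j) A))
              (\<lambda>g. cohom_map S U d (farr (pull S j) g))
              (supp_cohom S i R (d + 1)) (supp_cohom_map S i R (d + 1)) (connecting S i j R d))"
proof -
  interpret S: coefficient_system S by fact
  interpret R: recollement S i j R "coef_cat S (Cod (spaces S) i)" "coef_cat S (Dom (spaces S) i)"
      "coef_cat S (Dom (spaces S) j)"
    by fact
  have Cod_i: "Cod (spaces S) i = X" and Dom_i: "Dom (spaces S) i = Z"
    and Cod_j: "Cod (spaces S) j = X" and Dom_j: "Dom (spaces S) j = U"
    using assms(2,4) by (auto simp: Hom_def)
  let ?X = "coef_cat S X" and ?U = "coef_cat S U"
  let ?I = "push S i \<circ>\<^sub>F i_shriek R" and ?J = "push S j \<circ>\<^sub>F pull S j"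
  have Xo: "X \<in> Ob (spaces S)" and Uo: "U \<in> Ob (spaces S)"
    using S.spaces.Hom_ob[OF assms(4)] by auto
  interpret X: triangulated_category ?X by (rule S.coef_triangulated[OF Xo])
  interpret U: triangulated_category ?U by (rule S.coef_triangulated[OF Uo])
  interpret i: adjunction "coef_cat S Z" ?X "push S i" "i_shriek R" "i_shriek_unit R" "i_shriek_counit R"
    using R.i_push_shriek by (simp add: Cod_i Dom_i)
  interpret j: adjunction ?X ?U "pull S j" "push S j" "pp_unit S j" "pp_counit S j"
    by (rule S.pull_push_adj[OF assms(4)])
  interpret conn: nat_trans ?X ?X ?J "Shift ?X \<circ>\<^sub>F ?I" "conn_star R"
    using R.conn_star_natural by (simp add: Cod_i)
  interpret succ: nat_iso ?X ?X "shift_funct ?X d \<circ>\<^sub>F Shift ?X" "shift_funct ?X (d + 1)" "shift_succ ?X d" for d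
    by (rule X.shift_succ_nat_iso)
  have I: "is_functor ?X ?X ?I" by (rule is_functor_comp[OF i.right.is_functor_axioms i.left.is_functor_axioms])
  \<comment> \<open>Cohomology with support is seen as cohomology on X of i_* i^! A, so the general
    functoriality applies.\<close>
  have supp: "supp_cohom S i R d = (\<lambda>A. cohom S X d (fob ?I A))"
    and supp_map: "supp_cohom_map S i R d = (\<lambda>g. cohom_map S X d (farr ?I g))" for d
    by (simp_all add: supp_cohom_def supp_cohom_map_def fun_eq_iff Cod_i)
  have forg: "forg S i R d = (\<lambda>A. cohom_map S X d (i_shriek_counit R A))" for d
    by (simp add: forg_def fun_eq_iff Cod_i)
  have restr: "restr S j d = (\<lambda>A x. push_ident S j d (fob (pull S j) A) (cohom_map S X d (pp_unit S j A) x))" for d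
    by (simp add: restr_def fun_eq_iff Cod_j)
  have connecting: "connecting S i j R d = (\<lambda>A y. shift_succ ?X d (fob ?I A) \<cdot>\<^bsub>?X\<^esub>
      cohom_map S X d (conn_star R A)
        (inv_into (carrier (cohom S X d (fob ?J A))) (push_ident S j d (fob (pull S j) A)) y))" for d
    by (simp add: connecting_def fun_eq_iff Cod_i Let_def)

  have F_supp: "ab_functor ?X (supp_cohom S i R d) (supp_cohom_map S i R d)" for d
    unfolding supp supp_map by (rule S.ab_functor_cohom[OF Xo I])
  have F_X: "ab_functor ?X (cohom S X d) (cohom_map S X d)" for d
    using S.ab_functor_cohom[OF Xo X.is_functor_id] by (simp add: funct_simps)
  have F_U: "ab_functor ?X (\<lambda>A. cohom S U d (fob (pull S j) A)) (\<lambda>g. cohom_map S U d (farr (pull S j) g))" for d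
    by (rule S.ab_functor_cohom[OF Uo j.left.is_functor_axioms])
  have F_J: "ab_functor ?X (\<lambda>A. cohom S X d (fob ?J A)) (\<lambda>g. cohom_map S X d (farr ?J g))" for d
    by (rule S.ab_functor_cohom[OF Xo is_functor_comp[OF j.left.is_functor_axioms j.right.is_functor_axioms]])

  have N_forg: "ab_natural ?X (supp_cohom S i R d) (supp_cohom_map S i R d)
      (cohom S X d) (cohom_map S X d) (forg S i R d)" for d
    unfolding supp supp_map forg
    using S.ab_natural_cohom[OF Xo i.counit.nat_trans_axioms] by (simp only: funct_simps)
  have N_unit: "ab_natural ?X (cohom S X d) (cohom_map S X d)
      (\<lambda>A. cohom S X d (fob ?J A)) (\<lambda>g. cohom_map S X d (farr ?J g)) (\<lambda>A. cohom_map S X d (pp_unit S j A))" for d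
    using S.ab_natural_cohom[OF Xo j.unit.nat_trans_axioms] by (simp only: funct_simps)
  have N_push: "ab_natural ?X (\<lambda>A. cohom S X d (fob ?J A)) (\<lambda>g. cohom_map S X d (farr ?J g))
      (\<lambda>A. cohom S U d (fob (pull S j) A)) (\<lambda>g. cohom_map S U d (farr (pull S j) g))
      (\<lambda>A. push_ident S j d (fob (pull S j) A))" for d
    using ab_natural_pullback[OF S.push_ident_natural[OF assms(4)] j.left.is_functor_axioms]
    by (simp only: funct_simps)
  have P: "push_ident S j d (fob (pull S j) A)
      \<in> iso (cohom S X d (fob ?J A)) (cohom S U d (fob (pull S j) A))" if "A \<in> Ob ?X" for d A
    using S.push_ident_iso[OF assms(4) j.left.fob_closed[OF that]] by (simp only: funct_simps)
  have N_restr: "ab_natural ?X (cohom S X d) (cohom_map S X d)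
      (\<lambda>A. cohom S U d (fob (pull S j) A)) (\<lambda>g. cohom_map S U d (farr (pull S j) g)) (restr S j d)" for d
    unfolding restr by (rule ab_natural_comp[OF N_unit N_push X.category_axioms])
  have N_conn: "ab_natural ?X (\<lambda>A. cohom S X d (fob ?J A)) (\<lambda>g. cohom_map S X d (farr ?J g))
      (\<lambda>A. cohom S X d (fob (Shift ?X \<circ>\<^sub>F ?I) A)) (\<lambda>g. cohom_map S X d (farr (Shift ?X \<circ>\<^sub>F ?I) g))
      (\<lambda>A. cohom_map S X d (conn_star R A))" for d
    by (rule S.ab_natural_cohom[OF Xo conn.nat_trans_axioms])
  \<comment> \<open>Whiskering by i_* i^! makes \<open>shift_succ\<close> natural in A, with the
    support group of degree d+1 as target.\<close>
  have N_succ: "ab_natural ?X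
      (\<lambda>A. cohom S X d (fob (Shift ?X \<circ>\<^sub>F ?I) A)) (\<lambda>g. cohom_map S X d (farr (Shift ?X \<circ>\<^sub>F ?I) g))
      (supp_cohom S i R (d + 1)) (supp_cohom_map S i R (d + 1))
      (\<lambda>A x. shift_succ ?X d (fob ?I A) \<cdot>\<^bsub>?X\<^esub> x)" for d
  proof -
    interpret n: nat_iso ?X ?X "(shift_funct ?X d \<circ>\<^sub>F Shift ?X) \<circ>\<^sub>F ?I" "shift_funct ?X (d + 1) \<circ>\<^sub>F ?I"
        "\<lambda>A. shift_succ ?X d (fob ?I A)"
      by (rule nat_iso_whisker_right[OF succ.nat_iso_axioms I])
    show ?thesis
      using ab_natural_Hom[OF n.nat_trans_axioms X.additive_category_axioms S.unit_ob[OF Xo]]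
      by (simp add: supp supp_map cohom_def[abs_def] cohom_map_def[abs_def] funct_simps shift_funct_simps)
  qed
  \<comment> \<open>\<delta> is composed of three natural families: the inverse identification, the
    connecting morphism shifted by d, and \<open>shift_succ\<close>.\<close>
  have N_connecting: "ab_natural ?X (\<lambda>A. cohom S U d (fob (pull S j) A))
      (\<lambda>g. cohom_map S U d (farr (pull S j) g))
      (supp_cohom S i R (d + 1)) (supp_cohom_map S i R (d + 1)) (connecting S i j R d)" for d
    unfolding connecting
    by (rule ab_natural_comp[OF ab_natural_comp[OF ab_natural_inv[OF N_push F_J X.category_axioms P] N_conn]
          N_succ, OF _ X.category_axioms X.category_axioms])

  \<comment> \<open>Segments for consecutive d overlap in \<open>forg\<close>, so exactness at the
    three inner groups for all d covers every position of the long sequence.\<close>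
  have exact: "exact_seq (([supp_cohom S i R d A], [])
        \<longlongrightarrow>\<^bsub>forg S i R d A\<^esub> cohom S X d A
        \<longlongrightarrow>\<^bsub>restr S j d A\<^esub> cohom S U d (fob (pull S j) A)
        \<longlongrightarrow>\<^bsub>connecting S i j R d A\<^esub> supp_cohom S i R (d + 1) A
        \<longlongrightarrow>\<^bsub>forg S i R (d + 1) A\<^esub> cohom S X (d + 1) A)" if A: "A \<in> Ob ?X" for A d
  proof -
    have tri: "(i_shriek_counit R A, pp_unit S j A, conn_star R A) \<in> Dist ?X"
      using R.star_triangle[of A] A by (simp add: Cod_i)
    note hom = i.counit.component[OF A] j.unit.component[OF A] conn.component[OF A]
    note ex = X.dist_long_exact[OF tri hom[unfolded funct_simps(1,3)], of d]
    \<comment> \<open>The test object is now the unit on X, which turns exact pairs into equalities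
      of kernels and images.\<close>
    note ker = ex[THEN X.hom_exact_kernel, OF S.unit_ob[OF Xo]]
    let ?k = "shift_arr ?X d (conn_star R A)" and ?s = "shift_succ ?X d (fob ?I A)"
    let ?v = "\<lambda>z. ?s \<cdot>\<^bsub>?X\<^esub> cohom_map S X d (conn_star R A) z"
    let ?G1 = "supp_cohom S i R d A" and ?G2 = "cohom S X d A" and ?G3 = "cohom S X d (fob ?J A)"
      and ?G4 = "supp_cohom S i R (d + 1) A" and ?G5 = "cohom S X (d + 1) A"
      and ?H = "cohom S U d (fob (pull S j) A)"
    have k: "?k \<in> Hom ?X (shift_ob ?X d (fob ?J A)) (shift_ob ?X d (fob (Shift ?X) (fob ?I A)))"
      using is_functor.farr_hom[OF X.shift_funct_functor hom(3), of d]
      by (simp add: funct_simps shift_funct_simps)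
    have s: "?s \<in> Hom ?X (shift_ob ?X d (fob (Shift ?X) (fob ?I A))) (shift_ob ?X (d + 1) (fob ?I A))"
      using succ.component[OF is_functor.fob_closed[OF I A], of d]
      by (simp add: funct_simps shift_funct_simps)
    \<comment> \<open>\<open>connecting\<close> applies two arrows in succession, the exact pairs
      use their composite. Associativity holds for arrows with matching ends, so the two agree on
      the carrier, and kernels and images see no more.\<close>
    have v: "?v z = (?s \<cdot>\<^bsub>?X\<^esub> ?k) \<cdot>\<^bsub>?X\<^esub> z" if "z \<in> carrier ?G3" for z
      using X.comp_assoc[OF _ k s] that by (simp add: cohom_def cohom_map_def)
    have grp: "group ?G1" "group ?G2" "group ?G3" "group ?G4" "group ?G5" "group ?H"
      by (rule ab_functor_group[OF F_supp A] ab_functor_group[OF F_X A] ab_functor_group[OF F_J A]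
          ab_functor_group[OF F_U A])+
    have homs: "forg S i R d A \<in> hom ?G1 ?G2" "cohom_map S X d (pp_unit S j A) \<in> hom ?G2 ?G3"
        "forg S i R (d + 1) A \<in> hom ?G4 ?G5"
      by (rule ab_natural_hom[OF N_forg A] ab_natural_hom[OF N_unit A])+
    have vh: "?v \<in> hom ?G3 ?G4"
      by (rule ab_natural_hom[OF ab_natural_comp[OF N_conn N_succ X.category_axioms] A])
    have "kernel ?G3 ?G4 ?v = kernel ?G3 ?G4 (\<lambda>z. (?s \<cdot>\<^bsub>?X\<^esub> ?k) \<cdot>\<^bsub>?X\<^esub> z)"
      unfolding kernel_def using v by auto
    then have k3: "kernel ?G3 ?G4 ?v = cohom_map S X d (pp_unit S j A) ` carrier ?G2"
      using ker(2) by (simp add: supp cohom_def cohom_map_def funct_simps)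
    have "?v ` carrier ?G3 = (\<lambda>z. (?s \<cdot>\<^bsub>?X\<^esub> ?k) \<cdot>\<^bsub>?X\<^esub> z) ` carrier ?G3"
      using v by (rule image_cong[OF refl])
    then have k4: "kernel ?G4 ?G5 (forg S i R (d + 1) A) = ?v ` carrier ?G3"
      using ker(3) by (simp add: supp forg cohom_def cohom_map_def funct_simps)
    have k2: "kernel ?G2 ?G3 (cohom_map S X d (pp_unit S j A)) = forg S i R d A ` carrier ?G1"
      using ker(1) by (simp add: supp forg cohom_def cohom_map_def funct_simps)
    \<comment> \<open>The identification puts H^d(U; j^* A) in place of the group of j_* j^* A; the
      transported maps are \<open>restr\<close> and \<open>connecting\<close> by definition.\<close>
    show ?thesis
      using exact_seq_transport[OF grp homs(1,2) vh homs(3) P[OF A] k2 k3 k4]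
      unfolding restr connecting .
  qed
  show ?thesis
    using exact F_supp F_X F_U N_forg N_restr N_connecting by blast
qed

end
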